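(* Let $\mathbb{K}$ be an algebraically closed field of characteristic zero and let $B$ be a commutative $\mathbb{K}$-domain. Let $m,n_1,\dots,n_m$ be positive integers with $m\ge 3$, let $a_1,\dots,a_m\in\mathbb{K}^{\times}$, and for $1\le i\le m$, $1\le j\le n_i$ let $k_{ij}$ be positive integers and $b_{ij}\in B$, where the elements $b_{ij}$ generate $B$ as a $\mathbb{K}$-algebra. Put $$F_i:=a_i\, b_{i1}^{k_{i1}}\cdots b_{in_i}^{k_{in_i}}\in B,\qquad i=1,\dots,m,$$ and suppose that $F:=F_1+\dots+F_m$ is a prime element of $B$. Let $f_i$ denote the image of $F_i$ in the factor-algebra $B/(F)$. Assume that $f_1,\dots,f_m$ are pairwise relatively prime in $B/(F)$ and that $$\sum_{i=1}^{m}\sum_{j=1}^{n_i}\frac{1}{k_{ij}}\le \frac{1}{m-2}.$$ Then the algebra $B/(F)$ is rigid.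
   Context: A derivation on a commutative $\mathbb{K}$-domain $R$ is a $\mathbb{K}$-linear map $D:R\to R$ satisfying the Leibniz rule; it is locally nilpotent if for each $r\in R$ there is a non-negative integer $n$ with $D^n(r)=0$. A commutative $\mathbb{K}$-domain $R$ is rigid if there are no nonzero locally nilpotent derivations on $R$ (equivalently, the intersection of the kernels of all locally nilpotent derivations on $R$ equals $R$). Elements $r_1,r_2\in R$ are relatively prime in $R$ if $(r_1)\cap(r_2)=(r_1r_2)$ as ideals of $R$.
   Formalization: The formal theorem additionally assumes that every f_i is nonzero in B/(F); without this the claim is false, because under the given definition zero is relatively prime to every element (B/(F) can then be K[y], which is not rigid). *)

theory Defs
  imports "HOL-Algebra.Algebra"
begin

definition char_zero :: "('k, 'p) ring_scheme \<Rightarrow> bool" where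
  "char_zero K \<longleftrightarrow> (\<forall>n::nat. n > 0 \<longrightarrow> [n] \<cdot>\<^bsub>K\<^esub> \<one>\<^bsub>K\<^esub> \<noteq> \<zero>\<^bsub>K\<^esub>)"

text \<open>The locale \<^locale>\<open>subalgebra\<close> of HOL-Algebra only asks for closure under scalars (it is a
  linear subspace), so subalgebras in the usual unital sense are defined here.\<close>

definition unital_subalgebra ::
    "('k, 'p) ring_scheme \<Rightarrow> 'b set \<Rightarrow> ('k, 'b, 'q) module_scheme \<Rightarrow> bool" where
  "unital_subalgebra K V B \<longleftrightarrow>
     subring V B \<and> (\<forall>c\<in>carrier K. \<forall>v\<in>V. c \<odot>\<^bsub>B\<^esub> v \<in> V)"

definition generated_algebra ::
    "('k, 'p) ring_scheme \<Rightarrow> ('k, 'b, 'q) module_scheme \<Rightarrow> 'b set \<Rightarrow> 'b set" where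
  "generated_algebra K B S = \<Inter>{V. unital_subalgebra K V B \<and> S \<subseteq> V}"

definition quotient_algebra ::
    "('k, 'b, 'q) module_scheme \<Rightarrow> 'b set \<Rightarrow> ('k, 'b set) module" where
  "quotient_algebra B I =
     ring.extend (B Quot I) (module.fields (\<lambda>c C. \<Union>x\<in>C. I +>\<^bsub>B\<^esub> (c \<odot>\<^bsub>B\<^esub> x)))"

definition derivation ::
    "('k, 'p) ring_scheme \<Rightarrow> ('k, 'r, 'q) module_scheme \<Rightarrow> ('r \<Rightarrow> 'r) \<Rightarrow> bool" where
  "derivation K R D \<longleftrightarrow>
     D \<in> carrier R \<rightarrow> carrier R \<and>
     (\<forall>x\<in>carrier R. \<forall>y\<in>carrier R. D (x \<oplus>\<^bsub>R\<^esub> y) = D x \<oplus>\<^bsub>R\<^esub> D y) \<and>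
     (\<forall>c\<in>carrier K. \<forall>x\<in>carrier R. D (c \<odot>\<^bsub>R\<^esub> x) = c \<odot>\<^bsub>R\<^esub> D x) \<and>
     (\<forall>x\<in>carrier R. \<forall>y\<in>carrier R.
        D (x \<otimes>\<^bsub>R\<^esub> y) = (D x \<otimes>\<^bsub>R\<^esub> y) \<oplus>\<^bsub>R\<^esub> (x \<otimes>\<^bsub>R\<^esub> D y))"

definition locally_nilpotent :: "('r, 'q) ring_scheme \<Rightarrow> ('r \<Rightarrow> 'r) \<Rightarrow> bool" where
  "locally_nilpotent R D \<longleftrightarrow> (\<forall>r\<in>carrier R. \<exists>n::nat. (D ^^ n) r = \<zero>\<^bsub>R\<^esub>)"

text \<open>A map given on a carrier is nonzero when it is nonzero somewhere on that carrier; its values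
  outside the carrier are irrelevant.\<close>

definition rigid :: "('k, 'p) ring_scheme \<Rightarrow> ('k, 'r, 'q) module_scheme \<Rightarrow> bool" where
  "rigid K R \<longleftrightarrow>
     \<not> (\<exists>D. derivation K R D \<and> locally_nilpotent R D \<and> (\<exists>r\<in>carrier R. D r \<noteq> \<zero>\<^bsub>R\<^esub>))"

text \<open>Pitfall: with this definition zero is relatively prime to every element.\<close>

definition relatively_prime :: "('r, 'q) ring_scheme \<Rightarrow> 'r \<Rightarrow> 'r \<Rightarrow> bool" where
  "relatively_prime R x y \<longleftrightarrow> (PIdl\<^bsub>R\<^esub> x) \<inter> (PIdl\<^bsub>R\<^esub> y) = PIdl\<^bsub>R\<^esub> (x \<otimes>\<^bsub>R\<^esub> y)"

lemma quotient_algebra_simps [simp]: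
  "carrier (quotient_algebra B I) = carrier (B Quot I)"
  "monoid.mult (quotient_algebra B I) = monoid.mult (B Quot I)"
  "monoid.one (quotient_algebra B I) = monoid.one (B Quot I)"
  "ring.zero (quotient_algebra B I) = ring.zero (B Quot I)"
  "ring.add (quotient_algebra B I) = ring.add (B Quot I)"
  by (simp_all add: quotient_algebra_def ring.defs module.defs)

lemma smult_quotient_algebra:
  assumes "algebra K B" "ideal I B" "c \<in> carrier K" "x \<in> carrier B"
  shows "c \<odot>\<^bsub>quotient_algebra B I\<^esub> (I +>\<^bsub>B\<^esub> x) = I +>\<^bsub>B\<^esub> (c \<odot>\<^bsub>B\<^esub> x)"
proof -
  interpret algebra K B by fact
  interpret ideal I B by fact
  have "I +>\<^bsub>B\<^esub> (c \<odot>\<^bsub>B\<^esub> y) = I +>\<^bsub>B\<^esub> (c \<odot>\<^bsub>B\<^esub> x)" if y: "y \<in> I +>\<^bsub>B\<^esub> x" for y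
  proof -
    obtain h where h: "h \<in> I" "y = h \<oplus>\<^bsub>B\<^esub> x"
      using y by (auto simp: a_r_coset_def r_coset_def)
    have hB: "h \<in> carrier B" using h a_subset by blast
    have eq: "c \<odot>\<^bsub>B\<^esub> h = (c \<odot>\<^bsub>B\<^esub> \<one>\<^bsub>B\<^esub>) \<otimes>\<^bsub>B\<^esub> h"
      using smult_assoc2[of c "\<one>\<^bsub>B\<^esub>" h] hB assms(3) by simp
    have "c \<odot>\<^bsub>B\<^esub> h \<in> I"
      unfolding eq using h(1) assms(3) by (intro I_l_closed) auto
    moreover have "c \<odot>\<^bsub>B\<^esub> y = c \<odot>\<^bsub>B\<^esub> h \<oplus>\<^bsub>B\<^esub> c \<odot>\<^bsub>B\<^esub> x"
      using h hB assms(3,4) by (simp add: smult_r_distr)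
    ultimately have "c \<odot>\<^bsub>B\<^esub> y \<in> I +>\<^bsub>B\<^esub> (c \<odot>\<^bsub>B\<^esub> x)"
      by (auto simp: a_r_coset_def r_coset_def)
    then show ?thesis
      using a_repr_independence' assms(3,4) by (metis smult_closed)
  qed
  then have "(\<Union>y\<in>I +>\<^bsub>B\<^esub> x. I +>\<^bsub>B\<^esub> (c \<odot>\<^bsub>B\<^esub> y)) = I +>\<^bsub>B\<^esub> (c \<odot>\<^bsub>B\<^esub> x)"
    using a_rcos_self[OF assms(4)] by blast
  then show ?thesis
    by (simp only: quotient_algebra_def ring.defs module.defs module.simps)
qed

lemma algebra_quotient_algebra:
  assumes "algebra K B" "ideal I B"
  shows "algebra K (quotient_algebra B I)"
proof -
  interpret algebra K B by fact
  interpret ideal I B by fact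
  let ?Q = "quotient_algebra B I"
  have crQ: "cring (B Quot I)" using quotient_is_cring M_cring by blast
  have rep: "\<exists>x\<in>carrier B. C = I +>\<^bsub>B\<^esub> x" if "C \<in> carrier ?Q" for C
    using that by (auto simp: FactRing_def A_RCOSETS_def')
  have mem: "I +>\<^bsub>B\<^esub> x \<in> carrier ?Q" if "x \<in> carrier B" for x
    using that by (auto simp: FactRing_def A_RCOSETS_def')
  have add: "(I +>\<^bsub>B\<^esub> x) \<oplus>\<^bsub>?Q\<^esub> (I +>\<^bsub>B\<^esub> y) = I +>\<^bsub>B\<^esub> (x \<oplus>\<^bsub>B\<^esub> y)"
    if "x \<in> carrier B" "y \<in> carrier B" for x y
    using that by (simp add: FactRing_def a_rcos_sum)
  have mul: "(I +>\<^bsub>B\<^esub> x) \<otimes>\<^bsub>?Q\<^esub> (I +>\<^bsub>B\<^esub> y) = I +>\<^bsub>B\<^esub> (x \<otimes>\<^bsub>B\<^esub> y)"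
    if "x \<in> carrier B" "y \<in> carrier B" for x y
    using that by (simp add: FactRing_def rcoset_mult_add)
  note sm = smult_quotient_algebra[OF assms]
  interpret Q: cring "B Quot I" by fact
  have inv: "\<exists>D\<in>carrier (B Quot I). D \<oplus>\<^bsub>B Quot I\<^esub> C = \<zero>\<^bsub>B Quot I\<^esub>"
    if "C \<in> carrier (B Quot I)" for C
    using Q.l_neg[OF that] Q.a_inv_closed[OF that] by (rule bexI)
  have "abelian_group ?Q"
    by (rule abelian_groupI; unfold quotient_algebra_simps;
        (rule Q.a_closed Q.zero_closed Q.a_assoc Q.a_comm Q.l_zero inv; assumption?))
  moreover have "comm_monoid ?Q"
    by (rule comm_monoidI; unfold quotient_algebra_simps;
        (rule Q.m_closed Q.one_closed Q.m_assoc Q.m_comm Q.l_one; assumption?))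
  ultimately have crQ': "cring ?Q"
    by (rule cringI; unfold quotient_algebra_simps) (rule Q.l_distr)
  show ?thesis
  proof (rule algebraI[OF R_cring crQ'])
    fix c C assume c: "c \<in> carrier K" and C: "C \<in> carrier ?Q"
    obtain x where x: "x \<in> carrier B" "C = I +>\<^bsub>B\<^esub> x" using rep[OF C] by (elim bexE)
    show "c \<odot>\<^bsub>?Q\<^esub> C \<in> carrier ?Q"
      unfolding x(2) sm[OF c x(1)] by (rule mem[OF smult_closed[OF c x(1)]])
  next
    fix c d C assume c: "c \<in> carrier K" "d \<in> carrier K" and C: "C \<in> carrier ?Q"
    obtain x where x: "x \<in> carrier B" "C = I +>\<^bsub>B\<^esub> x" using rep[OF C] by (elim bexE)
    note cl = c x(1) smult_closed R.a_closed R.m_closed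
    show "(c \<oplus>\<^bsub>K\<^esub> d) \<odot>\<^bsub>?Q\<^esub> C = c \<odot>\<^bsub>?Q\<^esub> C \<oplus>\<^bsub>?Q\<^esub> d \<odot>\<^bsub>?Q\<^esub> C"
      by (simp only: x(2) sm add smult_l_distr cl)
    show "(c \<otimes>\<^bsub>K\<^esub> d) \<odot>\<^bsub>?Q\<^esub> C = c \<odot>\<^bsub>?Q\<^esub> (d \<odot>\<^bsub>?Q\<^esub> C)"
      by (simp only: x(2) sm smult_assoc1 cl)
  next
    fix c C E assume c: "c \<in> carrier K" and C: "C \<in> carrier ?Q" and E: "E \<in> carrier ?Q"
    obtain x where x: "x \<in> carrier B" "C = I +>\<^bsub>B\<^esub> x" using rep[OF C] by (elim bexE)
    obtain y where y: "y \<in> carrier B" "E = I +>\<^bsub>B\<^esub> y" using rep[OF E] by (elim bexE)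
    note cl = c x(1) y(1) smult_closed M.a_closed m_closed
    show "c \<odot>\<^bsub>?Q\<^esub> (C \<oplus>\<^bsub>?Q\<^esub> E) = c \<odot>\<^bsub>?Q\<^esub> C \<oplus>\<^bsub>?Q\<^esub> c \<odot>\<^bsub>?Q\<^esub> E"
      by (simp only: x(2) y(2) sm add smult_r_distr cl)
    show "(c \<odot>\<^bsub>?Q\<^esub> C) \<otimes>\<^bsub>?Q\<^esub> E = c \<odot>\<^bsub>?Q\<^esub> (C \<otimes>\<^bsub>?Q\<^esub> E)"
      by (simp only: x(2) y(2) sm mul smult_assoc2 cl)
  next
    fix C assume C: "C \<in> carrier ?Q"
    obtain x where x: "x \<in> carrier B" "C = I +>\<^bsub>B\<^esub> x" using rep[OF C] by (elim bexE)
    show "\<one>\<^bsub>K\<^esub> \<odot>\<^bsub>?Q\<^esub> C = C" by (simp only: x(2) sm R.one_closed x(1) smult_one)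
  qed
qed

end

theory Submission
  imports Defs "Jordan_Normal_Form.Determinant"
begin

text \<open>A nonzero locally nilpotent derivation \<open>D\<close> gives the domain \<open>A = B/(F)\<close> a degree function
  \<open>deg x = max {n. D\<^sup>n x \<noteq> 0}\<close> which is additive on products and drops by one under \<open>D\<close>, so Mason's proof
  of the \<open>abc\<close> theorem can be run inside \<open>A\<close>. Let \<open>f\<^sub>0\<close> be an \<open>f\<^sub>i\<close> of largest degree and let \<open>W\<close> be a nonzero
  Wronskian of as many as possible, say \<open>r \<le> m - 1\<close>, of the other \<open>f\<^sub>i\<close>. All \<open>f\<^sub>i\<close> are dependent on these
  over \<open>ker D\<close>, so by Cramer's rule a nonzero constant multiple of \<open>W\<close> is divisible by each
  \<open>\<Prod>\<^sub>j b\<^sub>i\<^sub>j\<^bsup>k\<^sub>i\<^sub>j - (r - 1)\<^esup>\<close>, and by relative primality it is divisible by the product of all these. Comparing degrees gives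
  \<open>deg f\<^sub>0 + r (r - 1) / 2 \<le> (r - 1) \<Sum> deg b\<^sub>i\<^sub>j\<close>. Since \<open>deg b\<^sub>i\<^sub>j \<le> deg f\<^sub>0 / k\<^sub>i\<^sub>j\<close>, the hypothesis on \<open>\<Sum> 1 / k\<^sub>i\<^sub>j\<close>
  forces \<open>deg f\<^sub>0 = 0\<close>; hence \<open>D\<close> kills the generators \<open>b\<^sub>i\<^sub>j\<close>.

  Determinants are available only over a ring that is a type. The argument is therefore carried out in the
  free commutative ring on the elements of \<open>A\<close>, modulo the prime ideal \<open>Z\<close> of relations holding
  in \<open>A\<close>.\<close>

section \<open>Adjugate matrices\<close>

lemma mat_adj_sum:
  fixes A :: "'a::comm_ring_1 mat"
  assumes "A \<in> carrier_mat n n" "i < n" "j < n"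
  shows "(\<Sum>k<n. A $$ (i, k) * adj_mat A $$ (k, j)) = (if i = j then det A else 0)"
proof -
  have "(A * adj_mat A) $$ (i, j) = (\<Sum>k<n. A $$ (i, k) * adj_mat A $$ (k, j))"
    using assms adj_mat(1)[OF assms(1)] by (auto simp: scalar_prod_def atLeast0LessThan)
  then show ?thesis unfolding adj_mat(2)[OF assms(1)] using assms by (cases "i = j") simp_all
qed

lemma adj_mat_sum:
  fixes A :: "'a::comm_ring_1 mat"
  assumes "A \<in> carrier_mat n n" "i < n" "j < n"
  shows "(\<Sum>k<n. adj_mat A $$ (i, k) * A $$ (k, j)) = (if i = j then det A else 0)"
proof -
  have "(adj_mat A * A) $$ (i, j) = (\<Sum>k<n. adj_mat A $$ (i, k) * A $$ (k, j))"
    using assms adj_mat(1)[OF assms(1)] by (auto simp: scalar_prod_def atLeast0LessThan)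
  then show ?thesis unfolding adj_mat(3)[OF assms(1)] using assms by (cases "i = j") simp_all
qed

text \<open>Cramer's rule without division: \<open>adj_mat A\<close> recovers the unknowns of a
  linear system up to the factor \<open>det A\<close>.\<close>

lemma adj_mat_apply:
  fixes A :: "'a::comm_ring_1 mat"
  assumes "A \<in> carrier_mat n n" "i < n"
  shows "(\<Sum>l<n. adj_mat A $$ (i, l) * (\<Sum>k<n. A $$ (l, k) * x k)) = det A * x i"
proof -
  have "(\<Sum>l<n. adj_mat A $$ (i, l) * (\<Sum>k<n. A $$ (l, k) * x k))
      = (\<Sum>l<n. \<Sum>k<n. adj_mat A $$ (i, l) * A $$ (l, k) * x k)"
    by (simp add: sum_distrib_left mult.assoc)
  also have "\<dots> = (\<Sum>k<n. \<Sum>l<n. adj_mat A $$ (i, l) * A $$ (l, k) * x k)"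
    by (rule sum.swap)
  also have "\<dots> = (\<Sum>k<n. (\<Sum>l<n. adj_mat A $$ (i, l) * A $$ (l, k)) * x k)"
    by (simp add: sum_distrib_right)
  also have "\<dots> = (\<Sum>k<n. (if i = k then det A else 0) * x k)"
    using adj_mat_sum[OF assms] by (intro sum.cong) auto
  also have "\<dots> = det A * x i"
    using assms(2) by (simp add: if_distrib[of "\<lambda>y. y * _"] cong: if_cong)
  finally show ?thesis .
qed

text \<open>Cramer's numerators as a solution: they solve the system whose right-hand side is
  \<open>y\<close> scaled by \<open>det A\<close>.\<close>

lemma mat_adj_apply:
  fixes A :: "'a::comm_ring_1 mat"
  assumes "A \<in> carrier_mat n n" "l < n"
  shows "(\<Sum>i<n. (\<Sum>j<n. adj_mat A $$ (i, j) * y j) * A $$ (l, i)) = det A * y l"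
proof -
  have "(\<Sum>i<n. (\<Sum>j<n. adj_mat A $$ (i, j) * y j) * A $$ (l, i))
      = (\<Sum>i<n. \<Sum>j<n. A $$ (l, i) * adj_mat A $$ (i, j) * y j)"
    by (simp add: sum_distrib_left sum_distrib_right ac_simps)
  also have "\<dots> = (\<Sum>j<n. \<Sum>i<n. A $$ (l, i) * adj_mat A $$ (i, j) * y j)"
    by (rule sum.swap)
  also have "\<dots> = (\<Sum>j<n. (\<Sum>i<n. A $$ (l, i) * adj_mat A $$ (i, j)) * y j)"
    by (simp add: sum_distrib_right)
  also have "\<dots> = (\<Sum>j<n. (if l = j then det A else 0) * y j)"
    using mat_adj_sum[OF assms] by (intro sum.cong) auto
  also have "\<dots> = det A * y l"
    using assms(2) by (simp add: if_distrib[of "\<lambda>y. y * _"] cong: if_cong)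
  finally show ?thesis .
qed

section \<open>Locally nilpotent derivations modulo a prime ideal\<close>

text \<open>The assumptions make the quotient by \<open>Z\<close> a domain of characteristic zero on
  which \<open>D\<close> induces a locally nilpotent derivation. Congruences replace the quotient,
  so that matrix entries stay in a type of class \<open>comm_ring_1\<close>.\<close>

locale locally_nilpotent_mod_prime =
  fixes D :: "'a::comm_ring_1 \<Rightarrow> 'a" and Z :: "'a set"
  assumes D_add: "D (x + y) = D x + D y"
    and D_mult: "D (x * y) = D x * y + x * D y"
    and Z_add: "x \<in> Z \<Longrightarrow> y \<in> Z \<Longrightarrow> x + y \<in> Z"
    and Z_mult: "x \<in> Z \<Longrightarrow> y * x \<in> Z"
    and Z_prime: "x * y \<in> Z \<Longrightarrow> x \<in> Z \<or> y \<in> Z"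
    and Z_char: "n > 0 \<Longrightarrow> of_nat n \<notin> Z"
    and D_Z: "x \<in> Z \<Longrightarrow> D x \<in> Z"
    and nilpotent: "\<exists>n. (D ^^ n) x \<in> Z"
    and Z_zero: "0 \<in> Z"
begin

section \<open>Congruence modulo \<open>Z\<close>\<close>

abbreviation eqZ (infix "\<equiv>\<^sub>Z" 50) where "x \<equiv>\<^sub>Z y \<equiv> x - y \<in> Z"

lemma Z_mult': "x \<in> Z \<Longrightarrow> x * y \<in> Z"
  using Z_mult[of x y] by (simp add: mult.commute)

lemma Z_minus: "x \<in> Z \<Longrightarrow> - x \<in> Z"
  using Z_mult[of x "-1"] by simp

lemma Z_diff: "x \<in> Z \<Longrightarrow> y \<in> Z \<Longrightarrow> x - y \<in> Z"
  using Z_add[of x "-y"] Z_minus[of y] by simp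

lemma Z_sum: "(\<And>i. i \<in> S \<Longrightarrow> g i \<in> Z) \<Longrightarrow> sum g S \<in> Z"
  by (induction S rule: infinite_finite_induct) (auto intro: Z_add Z_zero)

lemma Z_one: "1 \<notin> Z"
  using Z_char[of 1] by simp

lemma Z_mult_iff: "x * y \<in> Z \<longleftrightarrow> x \<in> Z \<or> y \<in> Z"
  using Z_prime Z_mult Z_mult' by blast

lemma Z_prod_iff: "finite S \<Longrightarrow> prod g S \<in> Z \<longleftrightarrow> (\<exists>i\<in>S. g i \<in> Z)"
  by (induction S rule: finite_induct) (auto simp: Z_mult_iff Z_one)

lemma Z_power: "x ^ n \<in> Z \<Longrightarrow> x \<in> Z"
  by (induction n) (auto simp: Z_mult_iff Z_one)

lemma eqZ_sym: "x \<equiv>\<^sub>Z y \<Longrightarrow> y \<equiv>\<^sub>Z x"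
  using Z_minus[of "x - y"] by simp

lemma eqZ_trans [trans]: "x \<equiv>\<^sub>Z y \<Longrightarrow> y \<equiv>\<^sub>Z z \<Longrightarrow> x \<equiv>\<^sub>Z z"
  using Z_add[of "x - y" "y - z"] by simp

lemma eqZ_Z: "x \<equiv>\<^sub>Z y \<Longrightarrow> x \<in> Z \<longleftrightarrow> y \<in> Z"
  using Z_add[of "x - y" y] Z_diff[of x "x - y"] by auto

lemma eqZ_add: "x \<equiv>\<^sub>Z x' \<Longrightarrow> y \<equiv>\<^sub>Z y' \<Longrightarrow> x + y \<equiv>\<^sub>Z x' + y'"
  using Z_add[of "x - x'" "y - y'"] by (simp add: algebra_simps)

lemma eqZ_mult_left: "x \<equiv>\<^sub>Z y \<Longrightarrow> c * x \<equiv>\<^sub>Z c * y"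
  using Z_mult[of "x - y" c] by (simp add: algebra_simps)

lemma eqZ_cancel: "c * x \<equiv>\<^sub>Z c * y \<Longrightarrow> c \<notin> Z \<Longrightarrow> x \<equiv>\<^sub>Z y"
  using Z_prime[of c "x - y"] by (simp add: algebra_simps)

lemma eqZ_sum: "(\<And>i. i \<in> S \<Longrightarrow> g i \<equiv>\<^sub>Z h i) \<Longrightarrow> sum g S \<equiv>\<^sub>Z sum h S"
  using Z_sum[of S "\<lambda>i. g i - h i"] by (simp add: sum_subtractf)

section \<open>Iterates of the derivation and the Leibniz formula\<close>

lemma D_zero [simp]: "D 0 = 0"
  using D_add[of 0 0] by simp

lemma D_one [simp]: "D 1 = 0"
  using D_mult[of 1 1] by simp

lemma D_minus: "D (- x) = - D x"
  using D_add[of x "-x"] by (simp add: eq_neg_iff_add_eq_0 add.commute)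

lemma D_diff: "D (x - y) = D x - D y"
  using D_add[of x "-y"] by (simp add: D_minus)

lemma D_sum: "D (sum g S) = (\<Sum>i\<in>S. D (g i))"
  by (induction S rule: infinite_finite_induct) (auto simp: D_add)

lemma D_eqZ: "x \<equiv>\<^sub>Z y \<Longrightarrow> D x \<equiv>\<^sub>Z D y"
  using D_Z[of "x - y"] by (simp add: D_diff)

lemma Dn_add: "(D ^^ n) (x + y) = (D ^^ n) x + (D ^^ n) y"
  by (induction n) (auto simp: D_add)

lemma Dn_diff: "(D ^^ n) (x - y) = (D ^^ n) x - (D ^^ n) y"
  by (induction n) (auto simp: D_diff)

lemma Dn_minus: "(D ^^ n) (- x) = - (D ^^ n) x"
  by (induction n) (auto simp: D_minus)

lemma Dn_zero [simp]: "(D ^^ n) 0 = 0"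
  by (induction n) auto

lemma Dn_sum: "(D ^^ n) (sum g S) = (\<Sum>i\<in>S. (D ^^ n) (g i))"
  by (induction S rule: infinite_finite_induct) (auto simp: Dn_add)

lemma Dn_Z: "x \<in> Z \<Longrightarrow> (D ^^ n) x \<in> Z"
  by (induction n) (auto simp: D_Z)

lemma Dn_mono_Z:
  assumes "(D ^^ n) x \<in> Z" "n \<le> k" shows "(D ^^ k) x \<in> Z"
proof -
  have "(D ^^ k) x = (D ^^ (k - n)) ((D ^^ n) x)"
    using assms(2) by (metis comp_apply funpow_add le_add_diff_inverse2)
  then show ?thesis using Dn_Z assms(1) by simp
qed

lemma Dn_mult:
  "(D ^^ n) (x * y) = (\<Sum>k\<le>n. of_nat (n choose k) * ((D ^^ k) x * (D ^^ (n - k)) y))"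
proof (induction n)
  case (Suc n)
  let ?d = "\<lambda>k l. (D ^^ k) x * (D ^^ l) y"
  have D_of_nat: "D (of_nat i) = 0" for i
    by (induction i) (auto simp: D_add)
  have "(D ^^ Suc n) (x * y) = D (\<Sum>k\<le>n. of_nat (n choose k) * ?d k (n - k))"
    by (simp add: Suc.IH)
  also have "\<dots> = (\<Sum>k\<le>n. of_nat (n choose k) * ?d (Suc k) (n - k))
                + (\<Sum>k\<le>n. of_nat (n choose k) * ?d k (Suc (n - k)))"
    by (simp add: D_sum D_of_nat D_mult algebra_simps sum.distrib)
  also have "(\<Sum>k\<le>n. of_nat (n choose k) * ?d (Suc k) (n - k))
      = (\<Sum>k\<le>n. of_nat (n choose k) * ?d (Suc k) (Suc n - Suc k))" by simp
  \<comment> \<open>The range may be extended to \<open>Suc n\<close> because the new binomial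
    coefficient is zero; splitting off \<open>k = 0\<close> then aligns both sums for Pascal's
    rule.\<close>
  also have "(\<Sum>k\<le>n. of_nat (n choose k) * ?d k (Suc (n - k)))
      = (\<Sum>k\<le>Suc n. of_nat (n choose k) * ?d k (Suc n - k))"
    by (auto intro!: sum.cong simp: Suc_diff_le binomial_eq_0 simp del: funpow.simps)
  also have "\<dots> = ?d 0 (Suc n) + (\<Sum>k\<le>n. of_nat (n choose Suc k) * ?d (Suc k) (Suc n - Suc k))"
    by (subst sum.atMost_Suc_shift) simp
  also have "(\<Sum>k\<le>n. of_nat (n choose k) * ?d (Suc k) (Suc n - Suc k)) + 
      (?d 0 (Suc n) + (\<Sum>k\<le>n. of_nat (n choose Suc k) * ?d (Suc k) (Suc n - Suc k)))
     = ?d 0 (Suc n) + (\<Sum>k\<le>n. of_nat (Suc n choose Suc k) * ?d (Suc k) (Suc n - Suc k))"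
    by (simp add: sum.distrib algebra_simps del: funpow.simps)
  also have "\<dots> = (\<Sum>k\<le>Suc n. of_nat (Suc n choose k) * ?d k (Suc n - k))"
    by (subst sum.atMost_Suc_shift) simp
  finally show ?case .
qed simp

section \<open>The degree function of a locally nilpotent derivation\<close>

text \<open>The bound may be negative, in which case \<open>ldeg_le x n\<close> says that \<open>x \<in> Z\<close>; this keeps bounds additive.\<close>

definition ldeg_le :: "'a \<Rightarrow> int \<Rightarrow> bool" where
  "ldeg_le x n \<longleftrightarrow> (\<forall>j::nat. int j > n \<longrightarrow> (D ^^ j) x \<in> Z)"

text \<open>On \<open>Z\<close> the value is \<open>0\<close>.\<close>

definition ldeg :: "'a \<Rightarrow> nat" where
  "ldeg x = (LEAST n. (D ^^ Suc n) x \<in> Z)"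

lemma ldeg_le_ldeg: "ldeg_le x (int (ldeg x))"
proof -
  obtain n where "(D ^^ n) x \<in> Z" using nilpotent by blast
  then have "(D ^^ Suc n) x \<in> Z" by (simp add: D_Z)
  then have "(D ^^ Suc (ldeg x)) x \<in> Z" unfolding ldeg_def by (rule LeastI)
  then show ?thesis unfolding ldeg_le_def
    by (auto intro: Dn_mono_Z[of "Suc (ldeg x)"] simp del: funpow.simps)
qed

lemma Dn_ldeg_notin: assumes "x \<notin> Z" shows "(D ^^ ldeg x) x \<notin> Z"
proof (cases "ldeg x")
  case 0 then show ?thesis using assms by simp
next
  case (Suc n)
  then have "n < (LEAST n. (D ^^ Suc n) x \<in> Z)" unfolding ldeg_def by linarith
  from not_less_Least[OF this] show ?thesis unfolding Suc .
qed

lemma ldeg_leI: assumes "ldeg_le x n" "x \<notin> Z" shows "int (ldeg x) \<le> n"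
  using assms(1) Dn_ldeg_notin[OF assms(2)] unfolding ldeg_le_def by (meson not_le)

lemma ldeg_eqI:
  assumes "(D ^^ n) x \<notin> Z" "ldeg_le x (int n)" shows "ldeg x = n"
proof -
  have "x \<notin> Z" using assms(1) Dn_Z by blast
  then have "ldeg x \<le> n" using ldeg_leI[OF assms(2)] by simp
  moreover have "n \<le> ldeg x"
  proof (rule ccontr)
    assume "\<not> n \<le> ldeg x"
    then have "int n > int (ldeg x)" by simp
    then show False using assms(1) ldeg_le_ldeg[of x] unfolding ldeg_le_def by blast
  qed
  ultimately show ?thesis by simp
qed

lemma ldeg_le_mult: assumes "ldeg_le x a" "ldeg_le y b" shows "ldeg_le (x * y) (a + b)"
  unfolding ldeg_le_def Dn_mult
proof (intro allI impI Z_sum)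
  fix j k :: nat assume j: "a + b < int j" and k: "k \<in> {..j}"
  \<comment> \<open>The two orders of derivation add up to \<open>j > a + b\<close>, so at least one
    factor is derived beyond its bound.\<close>
  then have "int k > a \<or> int (j - k) > b" by auto
  then show "of_nat (j choose k) * ((D ^^ k) x * (D ^^ (j - k)) y) \<in> Z"
    using assms unfolding ldeg_le_def by (auto simp: Z_mult_iff)
qed

lemma ldeg_le_sum: "(\<And>i. i \<in> S \<Longrightarrow> ldeg_le (g i) a) \<Longrightarrow> ldeg_le (sum g S) a"
  unfolding ldeg_le_def Dn_sum by (auto intro: Z_sum)

lemma ldeg_le_minus: "ldeg_le x a \<Longrightarrow> ldeg_le (- x) a"
  unfolding ldeg_le_def Dn_minus by (auto intro: Z_minus)

lemma ldeg_le_one: "ldeg_le 1 0"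
  unfolding ldeg_le_def
proof (intro allI impI)
  fix j :: nat assume "0 < int j"
  then obtain i where "j = Suc i" by (cases j) auto
  then show "(D ^^ j) 1 \<in> Z" by (simp add: funpow_Suc_right Z_zero del: funpow.simps(2))
qed

lemma ldeg_le_prod: "finite S \<Longrightarrow> (\<And>i. i \<in> S \<Longrightarrow> ldeg_le (g i) (a i)) \<Longrightarrow> ldeg_le (prod g S) (sum a S)"
  by (induction S rule: finite_induct) (auto intro: ldeg_le_mult ldeg_le_one)

lemma ldeg_le_Dn: "ldeg_le x a \<Longrightarrow> ldeg_le ((D ^^ l) x) (a - int l)"
  unfolding ldeg_le_def using funpow_add[of _ l D] by (metis add.commute comp_apply diff_less_eq of_nat_add)

text \<open>In the Leibniz expansion of order \<open>ldeg x + ldeg y\<close>, only the term deriving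
  each factor to its own degree survives modulo \<open>Z\<close>. Its binomial coefficient is
  nonzero by characteristic zero, and the product is nonzero by primality.\<close>

lemma ldeg_mult:
  assumes "x \<notin> Z" "y \<notin> Z" shows "ldeg (x * y) = ldeg x + ldeg y"
proof (rule ldeg_eqI)
  let ?a = "ldeg x" and ?b = "ldeg y"
  let ?t = "\<lambda>k. of_nat (?a + ?b choose k) * ((D ^^ k) x * (D ^^ (?a + ?b - k)) y)"
  have "(\<Sum>k\<in>{..?a + ?b} - {?a}. ?t k) \<in> Z"
  proof (rule Z_sum)
    fix k assume "k \<in> {..?a + ?b} - {?a}"
    then have "k > ?a \<or> ?a + ?b - k > ?b" by auto
    then show "?t k \<in> Z" using ldeg_le_ldeg[of x] ldeg_le_ldeg[of y] unfolding ldeg_le_def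
      by (auto simp: Z_mult_iff)
  qed
  moreover have "(D ^^ (?a + ?b)) (x * y) = ?t ?a + (\<Sum>k\<in>{..?a + ?b} - {?a}. ?t k)"
    unfolding Dn_mult by (rule sum.remove) auto
  ultimately have "(D ^^ (?a + ?b)) (x * y) \<equiv>\<^sub>Z ?t ?a" by simp
  moreover have "?t ?a \<notin> Z"
    using Dn_ldeg_notin assms Z_char[of "?a + ?b choose ?a"] by (simp add: Z_mult_iff)
  ultimately show "(D ^^ (?a + ?b)) (x * y) \<notin> Z" by (simp add: eqZ_Z)
  show "ldeg_le (x * y) (int (?a + ?b))" using ldeg_le_mult ldeg_le_ldeg by simp
qed

lemma ldeg_one [simp]: "ldeg 1 = 0"
  by (rule ldeg_eqI) (auto simp: Z_one ldeg_le_one)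

lemma ldeg_prod: "finite S \<Longrightarrow> (\<And>i. i \<in> S \<Longrightarrow> g i \<notin> Z) \<Longrightarrow> ldeg (prod g S) = (\<Sum>i\<in>S. ldeg (g i))"
  by (induction S rule: finite_induct) (auto simp: ldeg_mult Z_prod_iff)

lemma ldeg_power: "x \<notin> Z \<Longrightarrow> ldeg (x ^ n) = n * ldeg x"
  using ldeg_prod[of "{..<n}" "\<lambda>_. x"] by simp

lemma ldeg_eqZ: assumes "x \<equiv>\<^sub>Z y" shows "ldeg x = ldeg y"
proof -
  have "(D ^^ n) x \<equiv>\<^sub>Z (D ^^ n) y" for n using Dn_Z[OF assms] by (simp add: Dn_diff)
  then have "(D ^^ n) x \<in> Z \<longleftrightarrow> (D ^^ n) y \<in> Z" for n using eqZ_Z by blast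
  then show ?thesis unfolding ldeg_def by metis
qed

lemma ldeg_eq_0_iff: "ldeg x = 0 \<longleftrightarrow> D x \<in> Z"
proof
  show "D x \<in> Z" if "ldeg x = 0" using ldeg_le_ldeg[of x] that by (simp add: ldeg_le_def)
      (metis One_nat_def comp_apply funpow.simps(2) funpow_0 less_Suc_eq_0_disj)
  show "ldeg x = 0" if "D x \<in> Z" unfolding ldeg_def using that by (intro Least_eq_0) simp
qed

section \<open>Constants, and divisibility of derivatives by powers\<close>

lemma D_const_mult: "D c \<in> Z \<Longrightarrow> D (c * x) \<equiv>\<^sub>Z c * D x"
  by (simp add: D_mult Z_mult')

lemma Dn_const_mult: assumes "D c \<in> Z" shows "(D ^^ n) (c * x) \<equiv>\<^sub>Z c * (D ^^ n) x"
proof (induction n)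
  case (Suc n)
  show ?case using eqZ_trans[OF D_eqZ[OF Suc.IH] D_const_mult[OF assms]] by simp
qed (simp add: Z_zero)

lemma const_mult: "D c \<in> Z \<Longrightarrow> D d \<in> Z \<Longrightarrow> D (c * d) \<in> Z"
  by (simp add: D_mult Z_mult Z_mult' Z_add)

lemma const_prod: "(\<And>i. i \<in> S \<Longrightarrow> D (g i) \<in> Z) \<Longrightarrow> D (prod g S) \<in> Z"
  by (induction S rule: infinite_finite_induct) (auto simp: const_mult Z_zero)

lemma D_power_factor: "\<exists>e. D (x ^ Suc n) = x ^ n * e"
proof (induction n)
  case (Suc n)
  then obtain e where e: "D (x ^ Suc n) = x ^ n * e" by blast
  have "D (x ^ Suc (Suc n)) = D x * x ^ Suc n + x * D (x ^ Suc n)"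
    using D_mult[of x "x ^ Suc n"] by simp
  then have "D (x ^ Suc (Suc n)) = x ^ Suc n * (D x + e)" unfolding e by (simp add: algebra_simps)
  then show ?case by blast
qed simp

text \<open>By the product rule, one derivation costs each power at most one exponent. The cofactor
  \<open>c\<close> allows iteration: a derivative known only to be a multiple of the product is
  again of this form.\<close>

lemma D_prod_power_factor:
  assumes "finite S" "\<And>j. j \<in> S \<Longrightarrow> k j \<ge> 1"
  shows "(\<Prod>j\<in>S. b j ^ (k j - 1)) dvd D (c * (\<Prod>j\<in>S. b j ^ k j))"
  using assms
proof (induction S arbitrary: c rule: finite_induct)
  case (insert i S)
  let ?P = "\<Prod>j\<in>S. b j ^ k j" and ?Q = "\<Prod>j\<in>S. b j ^ (k j - 1)"
  have ki: "k i = Suc (k i - 1)" using insert.prems by force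
  obtain e where e: "D (b i ^ k i) = b i ^ (k i - 1) * e"
    using D_power_factor[of "b i" "k i - 1"] unfolding ki[symmetric] by blast
  have "?Q dvd c * ?P"
    by (intro dvd_mult prod_dvd_prod) (simp add: le_imp_power_dvd)
  then have 1: "b i ^ (k i - 1) * ?Q dvd D (b i ^ k i) * (c * ?P)"
    unfolding e by (intro mult_dvd_mono) auto
  have 2: "b i ^ (k i - 1) * ?Q dvd b i ^ k i * D (c * ?P)"
    using insert by (intro mult_dvd_mono le_imp_power_dvd) auto
  have "c * (\<Prod>j\<in>insert i S. b j ^ k j) = b i ^ k i * (c * ?P)"
    using insert by (simp add: ac_simps)
  then have "D (c * (\<Prod>j\<in>insert i S. b j ^ k j)) = D (b i ^ k i) * (c * ?P) + b i ^ k i * D (c * ?P)"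
    by (simp only: D_mult)
  then show ?case using dvd_add[OF 1 2] insert.hyps by (simp only: prod.insert not_False_eq_True)
qed simp

lemma Dn_prod_power_factor:
  assumes "finite S" "\<And>j. j \<in> S \<Longrightarrow> k j \<ge> l"
  shows "(\<Prod>j\<in>S. b j ^ (k j - l)) dvd (D ^^ l) (c * (\<Prod>j\<in>S. b j ^ k j))"
  using assms(2)
proof (induction l)
  case (Suc l)
  let ?Q = "\<Prod>j\<in>S. b j ^ (k j - l)"
  have "?Q dvd (D ^^ l) (c * (\<Prod>j\<in>S. b j ^ k j))" using Suc by force
  then obtain e where "(D ^^ l) (c * (\<Prod>j\<in>S. b j ^ k j)) = e * ?Q" by (metis dvdE mult.commute)
  then have "(D ^^ Suc l) (c * (\<Prod>j\<in>S. b j ^ k j)) = D (e * ?Q)" by simp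
  moreover have "(\<Prod>j\<in>S. b j ^ (k j - l - 1)) dvd D (e * ?Q)"
    using assms(1) Suc.prems by (intro D_prod_power_factor) force+
  ultimately show ?case by simp
qed simp


section \<open>Wronskians and the Mason inequality\<close>

definition wronskian :: "nat \<Rightarrow> (nat \<Rightarrow> 'a) \<Rightarrow> 'a mat" where
  "wronskian r h = mat r r (\<lambda>(l, i). (D ^^ l) (h i))"

lemma wronskian_carrier [simp]: "wronskian r h \<in> carrier_mat r r"
  by (simp add: wronskian_def)

lemma wronskian_index: "l < r \<Longrightarrow> i < r \<Longrightarrow> wronskian r h $$ (l, i) = (D ^^ l) (h i)"
  by (simp add: wronskian_def)

lemma wronskian_cong: "(\<And>i. i < r \<Longrightarrow> h i = h' i) \<Longrightarrow> wronskian r h = wronskian r h'"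
  by (auto simp: wronskian_def)

text \<open>Every term of the determinant expansion uses each column once and each order of
  derivation below \<open>r\<close> once, so all terms obey the same bound.\<close>

lemma ldeg_le_det_wronskian:
  assumes "\<And>i. i < r \<Longrightarrow> ldeg_le (h i) (d i)"
  shows "ldeg_le (det (wronskian r h)) ((\<Sum>i<r. d i) - (\<Sum>i<r. int i))"
  unfolding det_def'[OF wronskian_carrier]
proof (rule ldeg_le_sum)
  fix p assume "p \<in> {p. p permutes {0..<r}}"
  then have p: "p permutes {..<r}" by (simp add: atLeast0LessThan)
  have "ldeg_le (\<Prod>i<r. (D ^^ i) (h (p i))) (\<Sum>i<r. d (p i) - int i)"
    using assms permutes_in_image[OF p] by (intro ldeg_le_prod ldeg_le_Dn) auto
  also have "(\<Prod>i<r. (D ^^ i) (h (p i))) = (\<Prod>i = 0..<r. wronskian r h $$ (i, p i))"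
    using permutes_in_image[OF p]
    by (intro prod.cong) (auto simp: atLeast0LessThan wronskian_index)
  also have "(\<Sum>i<r. d (p i) - int i) = (\<Sum>i<r. d i) - (\<Sum>i<r. int i)"
    using sum.permute[OF p, of d] by (simp add: sum_subtractf comp_def)
  finally show "ldeg_le (signof p * (\<Prod>i = 0..<r. wronskian r h $$ (i, p i)))
      ((\<Sum>i<r. d i) - (\<Sum>i<r. int i))"
    by (cases p rule: sign_cases) (auto intro: ldeg_le_minus)
qed

text \<open>The hypothesis says that the quotient \<open>u / w\<close> has derivative zero, so that
  \<open>u\<close> is a constant times \<open>w\<close> and stays so under derivation. The proof is
  this argument with denominators cleared.\<close>

lemma Dn_proportional:
  assumes "w \<notin> Z" "w * D u \<equiv>\<^sub>Z u * D w"
  shows "w * (D ^^ n) u \<equiv>\<^sub>Z u * (D ^^ n) w"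
proof (induction n)
  case (Suc n)
  let ?S = "w * (D ^^ n) u - u * (D ^^ n) w"
  have "w * (w * (D ^^ Suc n) u - u * (D ^^ Suc n) w)
      = w * D ?S - D w * ?S + (w * D u - u * D w) * (D ^^ n) w"
    by (simp add: D_diff D_mult algebra_simps)
  also have "\<dots> \<in> Z"
    by (rule Z_add[OF Z_diff[OF Z_mult[OF D_Z[OF Suc.IH]] Z_mult[OF Suc.IH]] Z_mult'[OF assms(2)]])
  finally show ?case using assms(1) Z_prime by blast
qed (simp add: mult.commute Z_zero)

text \<open>Solving for the last column by Cramer's rule gives coefficients \<open>u i / w\<close>.
  The vanishing of the larger Wronskian makes the relation hold to one more order, and
  differentiating it shows that these quotients are constants.\<close>

lemma wronskian_dependent:
  assumes "det (wronskian r h) \<notin> Z" "det (wronskian (Suc r) h) \<in> Z"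
  shows "\<exists>\<alpha> \<beta>. D \<alpha> \<in> Z \<and> \<alpha> \<notin> Z \<and> (\<forall>i<r. D (\<beta> i) \<in> Z) \<and> \<alpha> * h r \<equiv>\<^sub>Z (\<Sum>i<r. \<beta> i * h i)"
proof -
  define A B where "A = wronskian r h" and "B = wronskian (Suc r) h"
  have A: "A \<in> carrier_mat r r" and B: "B \<in> carrier_mat (Suc r) (Suc r)"
    by (simp_all add: A_def B_def)
  define w where "w = det A"
  have w: "w \<notin> Z" using assms(1) by (simp add: w_def A_def)
  define u where "u i = (\<Sum>j<r. adj_mat A $$ (i, j) * (D ^^ j) (h r))" for i
  \<comment> \<open>\<open>p l\<close> is the defect, in row \<open>l\<close>, of the relation
    between column \<open>r\<close> and the earlier columns; Cramer's rule kills it for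
    \<open>l < r\<close>.\<close>
  define p where "p l = w * (D ^^ l) (h r) - (\<Sum>i<r. u i * (D ^^ l) (h i))" for l
  have p0: "p l = 0" if "l < r" for l
    using mat_adj_apply[OF A that, of "\<lambda>j. (D ^^ j) (h r)"] that
    by (simp add: p_def u_def w_def A_def wronskian_index)
  have pr: "p r \<in> Z"
  proof -
    \<comment> \<open>This combination of the columns of \<open>B\<close> vanishes outside row
      \<open>r\<close>, where it is \<open>- p r\<close>. Its last coefficient is \<open>- w\<close>
      and the last diagonal cofactor is \<open>w\<close>, so Cramer's rule yields
      \<open>w * p r = det B * w\<close>.\<close>
    define x where "x i = (if i < r then u i else - w)" for i
    have x: "(\<Sum>i<Suc r. B $$ (l, i) * x i) = (if l = r then - p r else 0)" if "l < Suc r" for l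
    proof -
      have "(\<Sum>i<Suc r. B $$ (l, i) * x i) = - p l"
        using that by (simp add: B_def wronskian_index x_def p_def mult.commute)
      then show ?thesis using p0 that by auto
    qed
    have "mat_delete B r r = A"
      by (rule eq_matI) (auto simp: A_def B_def mat_delete_def wronskian_def)
    then have "adj_mat B $$ (r, r) = w"
      using B by (simp add: adj_mat_def cofactor_def w_def)
    then have "(\<Sum>l<Suc r. adj_mat B $$ (r, l) * (\<Sum>i<Suc r. B $$ (l, i) * x i)) = - (w * p r)"
      using x by simp
    moreover have "(\<Sum>l<Suc r. adj_mat B $$ (r, l) * (\<Sum>i<Suc r. B $$ (l, i) * x i)) = - (det B * w)"
      using adj_mat_apply[OF B, of r x] by (simp add: x_def)
    ultimately have "w * p r = det B * w" by simp
    also have "\<dots> \<in> Z" using assms(2) by (simp add: B_def Z_mult')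
    finally show ?thesis using w Z_prime by blast
  qed
  have p: "p l \<in> Z" if "l \<le> r" for l
    using that p0 pr by (cases "l = r") (auto simp: Z_zero)
  \<comment> \<open>\<open>v i\<close> is the numerator of the derivative of
    \<open>u i / w\<close>.\<close>
  define v where "v i = w * D (u i) - u i * D w" for i
  have vA: "(\<Sum>i<r. A $$ (l, i) * v i) \<in> Z" if l: "l < r" for l
  proof -
    have "(\<Sum>i<r. A $$ (l, i) * v i)
        = w * (\<Sum>i<r. D (u i) * (D ^^ l) (h i)) - D w * (\<Sum>i<r. u i * (D ^^ l) (h i))"
      using l by (simp add: A_def wronskian_index v_def sum_distrib_left algebra_simps sum_subtractf)
    \<comment> \<open>Comparing row \<open>Suc l\<close> with the derivative of row \<open>l\<close>
      leaves only the terms in which a coefficient is derived.\<close>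
    also have "\<dots> = w * (p (Suc l) - D (p l)) + D w * p l"
      by (simp add: p_def D_diff D_mult D_sum sum.distrib algebra_simps)
    also have "\<dots> \<in> Z" using p l by (intro Z_add Z_mult Z_diff D_Z) auto
    finally show ?thesis .
  qed
  have v: "v i \<in> Z" if "i < r" for i
  proof -
    have "w * v i \<in> Z" unfolding w_def adj_mat_apply[OF A that, symmetric]
      by (intro Z_sum Z_mult[OF vA]) auto
    then show ?thesis using w Z_prime by blast
  qed
  \<comment> \<open>The last derivative of \<open>w\<close> outside \<open>Z\<close> is a constant.
    Deriving \<open>u i\<close> equally often preserves the ratio, so
    \<open>\<beta> i / \<alpha>\<close> stands for \<open>u i / w\<close> with constant numerator
    and denominator.\<close>
  define n where "n = ldeg w"
  define \<alpha> \<beta> where "\<alpha> = (D ^^ n) w" and "\<beta> i = (D ^^ n) (u i)" for i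
  have ratio: "w * (D ^^ l) (u i) \<equiv>\<^sub>Z u i * (D ^^ l) w" if "i < r" for i l
    using Dn_proportional[OF w] v[OF that] by (simp add: v_def)
  have D\<alpha>: "(D ^^ Suc n) w \<in> Z"
    using ldeg_le_ldeg[of w] unfolding n_def ldeg_le_def by (simp del: funpow.simps)
  have "D (\<beta> i) \<in> Z" if "i < r" for i
  proof -
    have "w * (D ^^ Suc n) (u i) \<in> Z"
      using eqZ_Z[OF ratio[OF that, of "Suc n"]] Z_mult[OF D\<alpha>, of "u i"] by blast
    then show ?thesis using w Z_prime by (auto simp: \<beta>_def)
  qed
  moreover have "\<alpha> * h r \<equiv>\<^sub>Z (\<Sum>i<r. \<beta> i * h i)"
  proof -
    have "w * (\<alpha> * h r - (\<Sum>i<r. \<beta> i * h i))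
        = \<alpha> * p 0 - (\<Sum>i<r. (w * \<beta> i - u i * \<alpha>) * h i)"
      by (simp add: p_def sum_distrib_left algebra_simps sum_subtractf)
    also have "\<dots> \<in> Z"
      using ratio[of _ n] by (intro Z_diff[OF Z_mult[OF p] Z_sum] Z_mult') (auto simp: \<alpha>_def \<beta>_def)
    finally show ?thesis using w Z_prime by blast
  qed
  moreover have "\<alpha> \<notin> Z" unfolding \<alpha>_def n_def using Dn_ldeg_notin[OF w] .
  ultimately show ?thesis using D\<alpha> by (intro exI[of _ \<alpha>] exI[of _ \<beta>]) (auto simp: \<alpha>_def)
qed

text \<open>Deriving the relation treats the \<open>\<beta> i\<close> as scalars, so they solve a
  linear system with the Wronskian matrix and a right-hand side divisible by \<open>g\<close>.
  Cramer's rule passes the divisibility on.\<close>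

lemma wronskian_factor:
  assumes g: "\<And>l. l < r \<Longrightarrow> g dvd (D ^^ l) x"
    and \<gamma>: "D \<gamma> \<in> Z" and \<beta>: "\<And>i. i < r \<Longrightarrow> D (\<beta> i) \<in> Z"
    and eq: "\<gamma> * x \<equiv>\<^sub>Z (\<Sum>i<r. \<beta> i * h i)" and i: "i < r"
  shows "\<exists>t. \<beta> i * det (wronskian r h) \<equiv>\<^sub>Z g * t"
proof -
  define A where "A = wronskian r h"
  have A: "A \<in> carrier_mat r r" by (simp add: A_def)
  obtain q where q: "\<And>l. l < r \<Longrightarrow> (D ^^ l) x = g * q l"
    using g unfolding dvd_def by metis
  have col: "(\<Sum>k<r. A $$ (l, k) * \<beta> k) \<equiv>\<^sub>Z g * (\<gamma> * q l)" if l: "l < r" for l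
  proof -
    have "(\<Sum>k<r. A $$ (l, k) * \<beta> k) = (\<Sum>k<r. \<beta> k * (D ^^ l) (h k))"
      using l by (simp add: A_def wronskian_index mult.commute)
    also have "\<dots> \<equiv>\<^sub>Z (\<Sum>k<r. (D ^^ l) (\<beta> k * h k))"
      using Dn_const_mult \<beta> by (intro eqZ_sum) (auto intro: eqZ_sym)
    also have "(\<Sum>k<r. (D ^^ l) (\<beta> k * h k)) = (D ^^ l) (\<Sum>k<r. \<beta> k * h k)"
      by (simp add: Dn_sum)
    also have "(D ^^ l) (\<Sum>k<r. \<beta> k * h k) \<equiv>\<^sub>Z (D ^^ l) (\<gamma> * x)"
      using Dn_Z[OF eqZ_sym[OF eq]] by (simp add: Dn_diff)
    also have "(D ^^ l) (\<gamma> * x) \<equiv>\<^sub>Z \<gamma> * (D ^^ l) x" by (rule Dn_const_mult[OF \<gamma>])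
    also have "\<gamma> * (D ^^ l) x = g * (\<gamma> * q l)" by (simp add: q[OF l] ac_simps)
    finally show ?thesis .
  qed
  have "\<beta> i * det A = (\<Sum>l<r. adj_mat A $$ (i, l) * (\<Sum>k<r. A $$ (l, k) * \<beta> k))"
    using adj_mat_apply[OF A i] by (simp add: mult.commute)
  also have "\<dots> \<equiv>\<^sub>Z (\<Sum>l<r. adj_mat A $$ (i, l) * (g * (\<gamma> * q l)))"
    using col by (intro eqZ_sum eqZ_mult_left) auto
  also have "(\<Sum>l<r. adj_mat A $$ (i, l) * (g * (\<gamma> * q l)))
      = g * (\<Sum>l<r. adj_mat A $$ (i, l) * (\<gamma> * q l))"
    by (simp add: sum_distrib_left ac_simps)
  finally show ?thesis unfolding A_def by blast
qed

section \<open>Relative primality modulo \<open>Z\<close>\<close>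

text \<open>Gauss' lemma form of \<open>(a) \<inter> (c) = (a c)\<close> in the quotient by \<open>Z\<close>, equivalent to it when \<open>a \<notin> Z\<close>.\<close>

definition coprimeZ :: "'a \<Rightarrow> 'a \<Rightarrow> bool" where
  "coprimeZ a c \<longleftrightarrow> (\<forall>y z. a * y \<equiv>\<^sub>Z c * z \<longrightarrow> (\<exists>t. y \<equiv>\<^sub>Z c * t))"

text \<open>Multiplying by the cofactors \<open>a'\<close> and \<open>c'\<close> turns a relation
  between divisors into one between the products; \<open>c'\<close> is cancelled afterwards.\<close>

lemma coprimeZ_divisors:
  assumes "coprimeZ (a * a') (c * c')" "c * c' \<notin> Z"
  shows "coprimeZ a c"
  unfolding coprimeZ_def
proof (intro allI impI)
  fix y z assume "a * y \<equiv>\<^sub>Z c * z"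
  then have "(a' * c') * (a * y) \<equiv>\<^sub>Z (a' * c') * (c * z)" by (rule eqZ_mult_left)
  then have "(a * a') * (c' * y) \<equiv>\<^sub>Z (c * c') * (a' * z)" by (simp add: ac_simps)
  then obtain t where "c' * y \<equiv>\<^sub>Z c * c' * t" using assms(1) unfolding coprimeZ_def by blast
  then have "c' * y \<equiv>\<^sub>Z c' * (c * t)" by (simp add: ac_simps)
  then show "\<exists>t. y \<equiv>\<^sub>Z c * t" using assms(2) eqZ_cancel by (blast intro: Z_mult)
qed

lemma coprimeZ_prod:
  "finite S \<Longrightarrow> (\<And>i. i \<in> S \<Longrightarrow> coprimeZ (g i) c) \<Longrightarrow> coprimeZ (prod g S) c"
proof (induction S rule: finite_induct)
  case (insert i S)
  show ?case unfolding coprimeZ_def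
  proof (intro allI impI)
    fix y z assume "prod g (insert i S) * y \<equiv>\<^sub>Z c * z"
    then have "g i * (prod g S * y) \<equiv>\<^sub>Z c * z" using insert.hyps by (simp add: mult.assoc)
    then obtain t where "prod g S * y \<equiv>\<^sub>Z c * t"
      using insert.prems[of i] unfolding coprimeZ_def by blast
    then show "\<exists>t. y \<equiv>\<^sub>Z c * t" using insert unfolding coprimeZ_def by blast
  qed
qed (auto simp: coprimeZ_def)

text \<open>Each new factor is coprime to the product of the earlier ones, so it divides the
  remaining cofactor.\<close>

lemma eqZ_prod_dvd:
  assumes "finite S" "\<And>i j. i \<in> S \<Longrightarrow> j \<in> S \<Longrightarrow> i \<noteq> j \<Longrightarrow> coprimeZ (g i) (g j)"
    and "\<And>i. i \<in> S \<Longrightarrow> \<exists>t. x \<equiv>\<^sub>Z g i * t"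
  shows "\<exists>t. x \<equiv>\<^sub>Z prod g S * t"
  using assms
proof (induction S rule: finite_induct)
  case empty
  then show ?case by (intro exI[of _ x]) (simp add: Z_zero)
next
  case (insert i S)
  obtain t where t: "x \<equiv>\<^sub>Z prod g S * t" using insert.IH insert.prems by blast
  obtain s where s: "x \<equiv>\<^sub>Z g i * s" using insert.prems by blast
  have "coprimeZ (prod g S) (g i)" using insert by (intro coprimeZ_prod) auto
  moreover have "prod g S * t \<equiv>\<^sub>Z g i * s" using eqZ_trans[OF eqZ_sym[OF t] s] .
  ultimately obtain y where "t \<equiv>\<^sub>Z g i * y" unfolding coprimeZ_def by blast
  from eqZ_trans[OF t eqZ_mult_left[OF this]] show ?case
    using insert.hyps by (intro exI[of _ y]) (simp add: ac_simps)
qed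


text \<open>Constants form a ring rather than a field, so \<open>\<gamma>\<close> serves as a common
  denominator of the coefficients.\<close>

definition dependent_on :: "nat \<Rightarrow> (nat \<Rightarrow> 'a) \<Rightarrow> 'a \<Rightarrow> bool" where
  "dependent_on r h x \<longleftrightarrow> (\<exists>\<gamma> \<beta>. D \<gamma> \<in> Z \<and> \<gamma> \<notin> Z \<and> (\<forall>i<r. D (\<beta> i) \<in> Z) \<and>
     \<gamma> * x \<equiv>\<^sub>Z (\<Sum>i<r. \<beta> i * h i))"

lemma dependent_on_zero: "dependent_on r h 0"
  unfolding dependent_on_def
  by (rule exI[of _ 1], rule exI[of _ "\<lambda>_. 0"]) (auto simp: Z_zero Z_one)

lemma dependent_on_member:
  assumes "i < r" shows "dependent_on r h (h i)"
  unfolding dependent_on_def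
  using assms by (intro exI[of _ 1] exI[of _ "\<lambda>j. if j = i then 1 else 0"])
    (auto simp: Z_zero Z_one if_distrib[of "\<lambda>y. y * _"] cong: if_cong)

lemma dependent_on_eqZ:
  assumes "dependent_on r h x" "y \<equiv>\<^sub>Z x" shows "dependent_on r h y"
  using assms eqZ_trans[OF eqZ_mult_left[OF assms(2)]] unfolding dependent_on_def by blast

lemma dependent_on_minus:
  assumes "dependent_on r h x" shows "dependent_on r h (- x)"
proof -
  obtain \<gamma> \<beta> where g: "D \<gamma> \<in> Z" "\<gamma> \<notin> Z" "\<forall>i<r. D (\<beta> i) \<in> Z" "\<gamma> * x \<equiv>\<^sub>Z (\<Sum>i<r. \<beta> i * h i)"
    using assms unfolding dependent_on_def by blast
  have "\<gamma> * (- x) \<equiv>\<^sub>Z (\<Sum>i<r. (- \<beta> i) * h i)"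
    using Z_minus[OF g(4)] by (simp add: sum_negf)
  then show ?thesis unfolding dependent_on_def using g
    by (intro exI[of _ \<gamma>] exI[of _ "\<lambda>i. - \<beta> i"]) (auto simp: D_minus Z_minus)
qed

lemma dependent_on_add:
  assumes "dependent_on r h x" "dependent_on r h y" shows "dependent_on r h (x + y)"
proof -
  obtain \<gamma> \<beta> where g: "D \<gamma> \<in> Z" "\<gamma> \<notin> Z" "\<forall>i<r. D (\<beta> i) \<in> Z" "\<gamma> * x \<equiv>\<^sub>Z (\<Sum>i<r. \<beta> i * h i)"
    using assms(1) unfolding dependent_on_def by blast
  obtain \<gamma>' \<beta>' where g': "D \<gamma>' \<in> Z" "\<gamma>' \<notin> Z" "\<forall>i<r. D (\<beta>' i) \<in> Z" "\<gamma>' * y \<equiv>\<^sub>Z (\<Sum>i<r. \<beta>' i * h i)"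
    using assms(2) unfolding dependent_on_def by blast
  have "\<gamma>' * (\<gamma> * x) + \<gamma> * (\<gamma>' * y)
      \<equiv>\<^sub>Z \<gamma>' * (\<Sum>i<r. \<beta> i * h i) + \<gamma> * (\<Sum>i<r. \<beta>' i * h i)"
    using g(4) g'(4) by (intro eqZ_add eqZ_mult_left)
  then have "(\<gamma> * \<gamma>') * (x + y) \<equiv>\<^sub>Z (\<Sum>i<r. (\<gamma>' * \<beta> i + \<gamma> * \<beta>' i) * h i)"
    by (simp add: sum_distrib_left sum.distrib algebra_simps)
  moreover have "D (\<gamma> * \<gamma>') \<in> Z" "\<gamma> * \<gamma>' \<notin> Z" "\<forall>i<r. D (\<gamma>' * \<beta> i + \<gamma> * \<beta>' i) \<in> Z"
    using g g' by (auto simp: Z_mult_iff D_add intro!: const_mult Z_add)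
  ultimately show ?thesis unfolding dependent_on_def
    by (intro exI[of _ "\<gamma> * \<gamma>'"] exI[of _ "\<lambda>i. \<gamma>' * \<beta> i + \<gamma> * \<beta>' i"]) blast
qed

lemma dependent_on_sum:
  "(\<And>i. i \<in> S \<Longrightarrow> dependent_on r h (g i)) \<Longrightarrow> dependent_on r h (sum g S)"
  by (induction S rule: infinite_finite_induct) (auto intro: dependent_on_add dependent_on_zero)

text \<open>As \<open>x\<close> is nonzero modulo \<open>Z\<close>, so is some coefficient of its
  relation to the \<open>h i\<close>; that coefficient serves as \<open>c\<close>.\<close>

lemma wronskian_divisible:
  assumes dep: "dependent_on r h x" and x: "x \<notin> Z" and g: "\<And>l. l < r \<Longrightarrow> g dvd (D ^^ l) x"
  shows "\<exists>c t. D c \<in> Z \<and> c \<notin> Z \<and> c * det (wronskian r h) \<equiv>\<^sub>Z g * t"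
proof -
  obtain \<gamma> \<beta> where b: "D \<gamma> \<in> Z" "\<gamma> \<notin> Z" "\<And>i. i < r \<Longrightarrow> D (\<beta> i) \<in> Z" "\<gamma> * x \<equiv>\<^sub>Z (\<Sum>i<r. \<beta> i * h i)"
    using dep unfolding dependent_on_def by blast
  have "\<gamma> * x \<notin> Z" using b x by (simp add: Z_mult_iff)
  then have "(\<Sum>i<r. \<beta> i * h i) \<notin> Z" using eqZ_Z[OF b(4)] by blast
  moreover have "(\<Sum>i<r. \<beta> i * h i) \<in> Z" if "\<forall>i<r. \<beta> i \<in> Z"
    by (rule Z_sum, rule Z_mult') (use that in simp)
  ultimately obtain i where i: "i < r" "\<beta> i \<notin> Z" by blast
  then show ?thesis using wronskian_factor[OF g b(1) b(3) b(4) i(1)] b(3)[OF i(1)] by blast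
qed

text \<open>Choosing the Wronskian of maximal size, instead of \<open>m - 1\<close> fixed elements, makes a separate treatment
  of vanishing subsums unnecessary.\<close>

lemma maximal_wronskian:
  assumes M: "finite M" and i0: "i0 \<in> M" and f0: "(\<Sum>i\<in>M. f i) \<in> Z"
  obtains r \<sigma> where "inj_on \<sigma> {..<r}" "\<sigma> ` {..<r} \<subseteq> M - {i0}"
    "det (wronskian r (f \<circ> \<sigma>)) \<notin> Z" "\<And>j. j \<in> M \<Longrightarrow> dependent_on r (f \<circ> \<sigma>) (f j)"
proof -
  define P where "P r \<longleftrightarrow> (\<exists>\<sigma>. inj_on \<sigma> {..<r} \<and> \<sigma> ` {..<r} \<subseteq> M - {i0} \<and>
    det (wronskian r (f \<circ> \<sigma>)) \<notin> Z)" for r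
  \<comment> \<open>The empty determinant is \<open>1\<close>, so size zero is always
    available.\<close>
  have "P 0" unfolding P_def using Z_one by (simp add: det_dim_zero[OF wronskian_carrier])
  moreover have "\<forall>r. P r \<longrightarrow> r \<le> card M"
  proof (intro allI impI)
    fix r assume "P r"
    then obtain \<sigma> where "inj_on \<sigma> {..<r}" "\<sigma> ` {..<r} \<subseteq> M" unfolding P_def by blast
    then show "r \<le> card M" using M card_inj_on_le by fastforce
  qed
  ultimately obtain r where r: "P r" "\<And>r'. P r' \<Longrightarrow> r' \<le> r"
    using Greatest_le_nat[of P] GreatestI_nat[of P] by blast
  then obtain \<sigma> where s: "inj_on \<sigma> {..<r}" "\<sigma> ` {..<r} \<subseteq> M - {i0}"
    "det (wronskian r (f \<circ> \<sigma>)) \<notin> Z" unfolding P_def by blast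
  have dep: "dependent_on r (f \<circ> \<sigma>) (f j)" if j: "j \<in> M - {i0}" for j
  proof (cases "j \<in> \<sigma> ` {..<r}")
    case True
    then show ?thesis using dependent_on_member[of _ r "f \<circ> \<sigma>"] by auto
  next
    case False
    \<comment> \<open>By maximality, appending \<open>f j\<close> as the last column makes the
      Wronskian vanish.\<close>
    define \<tau> where "\<tau> = \<sigma>(r := j)"
    have "inj_on \<tau> {..<Suc r}"
      using s(1) False by (auto simp: \<tau>_def inj_on_def lessThan_Suc)
    moreover have "\<tau> ` {..<Suc r} \<subseteq> M - {i0}"
      using s(2) j by (auto simp: \<tau>_def lessThan_Suc)
    moreover have "\<not> P (Suc r)" using r(2)[of "Suc r"] by auto
    ultimately have "det (wronskian (Suc r) (f \<circ> \<tau>)) \<in> Z" unfolding P_def by blast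
    moreover have "wronskian r (f \<circ> \<tau>) = wronskian r (f \<circ> \<sigma>)"
      by (rule wronskian_cong) (simp add: \<tau>_def)
    ultimately have "dependent_on r (f \<circ> \<tau>) ((f \<circ> \<tau>) r)"
      using wronskian_dependent[of r "f \<circ> \<tau>"] s(3) unfolding dependent_on_def by argo
    then show ?thesis by (simp add: dependent_on_def \<tau>_def)
  qed
  \<comment> \<open>Modulo \<open>Z\<close> the excluded element is minus the sum of the
    others.\<close>
  have "dependent_on r (f \<circ> \<sigma>) (f i0)"
  proof (rule dependent_on_eqZ)
    show "dependent_on r (f \<circ> \<sigma>) (- (\<Sum>i\<in>M - {i0}. f i))"
      using dep by (intro dependent_on_minus dependent_on_sum)
    show "f i0 \<equiv>\<^sub>Z - (\<Sum>i\<in>M - {i0}. f i)"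
      using f0 sum.remove[OF M i0, of f] by simp
  qed
  then show ?thesis using that[OF s] dep by blast
qed

theorem mason_const:
  fixes f :: "'i \<Rightarrow> 'a" and b :: "'i \<Rightarrow> 'j \<Rightarrow> 'a"
  assumes M: "finite M" and m: "card M \<ge> 3" and J: "\<And>i. i \<in> M \<Longrightarrow> finite (J i)"
    and c: "\<And>i. i \<in> M \<Longrightarrow> D (c i) \<in> Z"
    and f: "\<And>i. i \<in> M \<Longrightarrow> f i = c i * (\<Prod>j\<in>J i. b i j ^ k i j)"
    and fZ: "\<And>i. i \<in> M \<Longrightarrow> f i \<notin> Z" and f0: "(\<Sum>i\<in>M. f i) \<in> Z"
    and cop: "\<And>i j. i \<in> M \<Longrightarrow> j \<in> M \<Longrightarrow> i \<noteq> j \<Longrightarrow> coprimeZ (f i) (f j)"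
    and k: "\<And>i j. i \<in> M \<Longrightarrow> j \<in> J i \<Longrightarrow> k i j \<ge> 1"
    and le: "(\<Sum>i\<in>M. \<Sum>j\<in>J i. 1 / real (k i j)) \<le> 1 / (real (card M) - 2)"
    and i: "i \<in> M" and j: "j \<in> J i"
  shows "D (b i j) \<in> Z"
proof -
  let ?m = "card M"
  let ?d = "\<lambda>i. ldeg (f i)" and ?e = "\<lambda>i j. ldeg (b i j)"
  have bZ: "b i j \<notin> Z" if "i \<in> M" "j \<in> J i" for i j
  proof
    assume "b i j \<in> Z"
    then have "b i j ^ k i j \<in> Z" using k[OF that] by (cases "k i j") (auto simp: Z_mult')
    then have "(\<Prod>j\<in>J i. b i j ^ k i j) \<in> Z"
      using Z_prod_iff[OF J[OF that(1)]] that(2) by blast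
    then show False using fZ[OF that(1)] Z_mult unfolding f[OF that(1)] by blast
  qed
  have cZ: "c i \<notin> Z" if "i \<in> M" for i
    using fZ[OF that] by (auto simp: f[OF that] Z_mult_iff)
  \<comment> \<open>A single reciprocal already obeys the bound on the whole sum. With
    \<open>r \<le> ?m - 1\<close> this gives \<open>r - 1 \<le> k i j\<close>, so the exponents
    \<open>k i j - (r - 1)\<close> are not truncated.\<close>
  have km: "k i j \<ge> ?m - 2" if "i \<in> M" "j \<in> J i" for i j
  proof -
    have "1 / real (k i j) \<le> (\<Sum>j\<in>J i. 1 / real (k i j))"
      using that(2) J[OF that(1)] by (intro member_le_sum[of j "J i" "\<lambda>j. 1 / real (k i j)"]) auto
    also have "\<dots> \<le> (\<Sum>i\<in>M. \<Sum>j\<in>J i. 1 / real (k i j))"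
      using that(1) M
      by (intro member_le_sum[of i M "\<lambda>i. \<Sum>j\<in>J i. 1 / real (k i j)"]) (auto intro: sum_nonneg)
    finally have "1 / real (k i j) \<le> 1 / (real ?m - 2)" using le by linarith
    then have "real ?m - 2 \<le> real (k i j)"
      using k[OF that] m by (simp add: divide_le_eq le_divide_eq)
    then show ?thesis by linarith
  qed
  have powZ: "b i j ^ n \<notin> Z" if "i \<in> M" "j \<in> J i" for i j n
    using bZ[OF that] Z_power by blast
  have prodZ: "(\<Prod>j\<in>J i. b i j ^ n j) \<notin> Z" if "i \<in> M" for i n
    using powZ[OF that] J[OF that] by (simp add: Z_prod_iff)
  have deg_prod: "ldeg (\<Prod>j\<in>J i. b i j ^ n j) = (\<Sum>j\<in>J i. n j * ?e i j)" if "i \<in> M" for i n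
  proof -
    have "ldeg (\<Prod>j\<in>J i. b i j ^ n j) = (\<Sum>j\<in>J i. ldeg (b i j ^ n j))"
      by (rule ldeg_prod[OF J[OF that] powZ[OF that]])
    then show ?thesis using ldeg_power[OF bZ[OF that]] by simp
  qed
  have deg_f: "?d i = (\<Sum>j\<in>J i. k i j * ?e i j)" if "i \<in> M" for i
  proof -
    have "?d i = ldeg (c i) + ldeg (\<Prod>j\<in>J i. b i j ^ k i j)"
      unfolding f[OF that] by (rule ldeg_mult[OF cZ[OF that] prodZ[OF that]])
    moreover have "ldeg (c i) = 0" using c[OF that] by (simp add: ldeg_eq_0_iff)
    ultimately show ?thesis by (simp add: deg_prod[OF that])
  qed
  \<comment> \<open>An element of largest degree is left out of the Wronskian; its degree is what
    the final inequality gains.\<close>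
  obtain i0 where i0: "i0 \<in> M" "\<And>i. i \<in> M \<Longrightarrow> ?d i \<le> ?d i0"
  proof -
    have "Max (?d ` M) \<in> ?d ` M" using i M by (intro Max_in) auto
    then obtain i0 where i0: "Max (?d ` M) = ?d i0" "i0 \<in> M" by (rule imageE)
    have "?d i \<le> ?d i0" if "i \<in> M" for i unfolding i0(1)[symmetric] using M that by simp
    then show ?thesis by (rule that[OF i0(2)])
  qed
  obtain r \<sigma> where \<sigma>: "inj_on \<sigma> {..<r}" "\<sigma> ` {..<r} \<subseteq> M - {i0}"
    and W: "det (wronskian r (f \<circ> \<sigma>)) \<notin> Z"
    and dep: "\<And>j. j \<in> M \<Longrightarrow> dependent_on r (f \<circ> \<sigma>) (f j)"
    by (rule maximal_wronskian[OF M i0(1) f0]) metis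
  let ?W = "det (wronskian r (f \<circ> \<sigma>))"
  have rm: "r \<le> ?m - 1"
    using card_inj_on_le[OF \<sigma>] M i0(1) by simp
  \<comment> \<open>Rows of the Wronskian carry at most \<open>r - 1\<close> derivations, so this
    part of \<open>f i\<close> divides all the derivatives involved. For \<open>r = 0\<close> the
    truncated \<open>r - 1\<close> is \<open>0\<close>.\<close>
  define g where "g i = (\<Prod>j\<in>J i. b i j ^ (k i j - (r - 1)))" for i
  have "\<exists>c' t. D c' \<in> Z \<and> c' \<notin> Z \<and> c' * ?W \<equiv>\<^sub>Z g i * t" if i: "i \<in> M" for i
  proof (rule wronskian_divisible[OF dep[OF i] fZ[OF i]])
    fix l assume l: "l < r"
    have "g i dvd (\<Prod>j\<in>J i. b i j ^ (k i j - l))"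
      unfolding g_def using l by (intro prod_dvd_prod le_imp_power_dvd) auto
    also have "\<dots> dvd (D ^^ l) (f i)"
      unfolding f[OF i] using J[OF i] km[OF i] l rm by (intro Dn_prod_power_factor) force+
    finally show "g i dvd (D ^^ l) (f i)" .
  qed
  then obtain c' where c': "\<And>i. i \<in> M \<Longrightarrow> D (c' i) \<in> Z" "\<And>i. i \<in> M \<Longrightarrow> c' i \<notin> Z"
    "\<And>i. i \<in> M \<Longrightarrow> \<exists>t. c' i * ?W \<equiv>\<^sub>Z g i * t"
    by (atomize_elim, unfold all_conj_distrib[symmetric] imp_conjR[symmetric]) (rule choice, blast)
  \<comment> \<open>One constant multiplier for all \<open>i\<close>: the divisors
    \<open>g i\<close> then divide the same element and can be combined by relative
    primality.\<close>
  define C where "C = prod c' M"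
  have C: "D C \<in> Z" "C \<notin> Z" unfolding C_def using c' M by (auto simp: Z_prod_iff intro: const_prod)
  have "\<exists>t. C * ?W \<equiv>\<^sub>Z prod g M * t"
  proof (rule eqZ_prod_dvd[OF M])
    fix i assume i: "i \<in> M"
    obtain t where "c' i * ?W \<equiv>\<^sub>Z g i * t" using c'(3)[OF i] by blast
    then have "prod c' (M - {i}) * (c' i * ?W) \<equiv>\<^sub>Z prod c' (M - {i}) * (g i * t)"
      by (rule eqZ_mult_left)
    then have "C * ?W \<equiv>\<^sub>Z g i * (prod c' (M - {i}) * t)"
      unfolding C_def prod.remove[OF M i] by (simp add: ac_simps)
    then show "\<exists>t. C * ?W \<equiv>\<^sub>Z g i * t" by blast
  next
    have fg: "\<exists>e. f i = g i * e" if i: "i \<in> M" for i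
    proof -
      have "g i dvd (\<Prod>j\<in>J i. b i j ^ k i j)"
        unfolding g_def by (intro prod_dvd_prod le_imp_power_dvd) auto
      then show ?thesis unfolding f[OF i] by (metis dvd_def dvd_mult)
    qed
    fix i j assume ij: "i \<in> M" "j \<in> M" "i \<noteq> j"
    obtain e e' where "f i = g i * e" "f j = g j * e'" using fg ij by blast
    then show "coprimeZ (g i) (g j)"
      using cop[OF ij] fZ[OF ij(2)] by (auto intro: coprimeZ_divisors)
  qed
  then obtain t where t: "C * ?W \<equiv>\<^sub>Z prod g M * t" by blast
  have "C * ?W \<notin> Z" using C W by (simp add: Z_mult_iff)
  then have gt: "prod g M * t \<notin> Z" using eqZ_Z[OF t] by blast
  then have "prod g M \<notin> Z" "t \<notin> Z" by (auto simp: Z_mult_iff)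
  \<comment> \<open>A divisor has no larger degree, and the constant \<open>C\<close> adds
    none.\<close>
  then have "ldeg (prod g M) \<le> ldeg (prod g M * t)" by (simp add: ldeg_mult)
  also have "\<dots> = ldeg ?W" using ldeg_eqZ[OF t] ldeg_mult[OF C(2) W] C(1) by (simp add: ldeg_eq_0_iff[THEN iffD2])
  finally have degW: "ldeg (prod g M) \<le> ldeg ?W" .
  have deg_g: "ldeg (prod g M) = (\<Sum>i\<in>M. \<Sum>j\<in>J i. (k i j - (r - 1)) * ?e i j)"
    using M prodZ by (subst ldeg_prod) (auto simp: g_def deg_prod)
  have sum_e: "real (ldeg (prod g M)) = (\<Sum>i\<in>M. real (?d i)) - real (r - 1) * (\<Sum>i\<in>M. \<Sum>j\<in>J i. real (?e i j))"
  proof -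
    have "real ((k i j - (r - 1)) * ?e i j) = real (k i j * ?e i j) - real (r - 1) * real (?e i j)"
      if "i \<in> M" "j \<in> J i" for i j
    proof -
      have "r - 1 \<le> k i j" using km[OF that] rm by linarith
      then have "real (k i j - (r - 1)) = real (k i j) - real (r - 1)" by (rule of_nat_diff)
      then show ?thesis unfolding of_nat_mult by (simp add: left_diff_distrib)
    qed
    then show ?thesis unfolding deg_g
      by (simp add: deg_f sum_subtractf sum_distrib_left)
  qed
  have "int (ldeg ?W) \<le> (\<Sum>i<r. int (?d (\<sigma> i))) - (\<Sum>i<r. int i)"
    using ldeg_leI[OF ldeg_le_det_wronskian W, of "\<lambda>i. int (?d (\<sigma> i))"] ldeg_le_ldeg by simp
  then have "real_of_int (int (ldeg ?W)) \<le> real_of_int ((\<Sum>i<r. int (?d (\<sigma> i))) - (\<Sum>i<r. int i))"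
    by (simp only: of_int_le_iff)
  then have "real (ldeg ?W) \<le> (\<Sum>i<r. real (?d (\<sigma> i))) - (\<Sum>i<r. real i)" by simp
  also have "(\<Sum>i<r. real (?d (\<sigma> i))) = (\<Sum>i\<in>\<sigma> ` {..<r}. real (?d i))"
    by (simp add: sum.reindex[OF \<sigma>(1)])
  also have "\<dots> \<le> (\<Sum>i\<in>M - {i0}. real (?d i))" using \<sigma>(2) M by (intro sum_mono2) auto
  also have "\<dots> = (\<Sum>i\<in>M. real (?d i)) - real (?d i0)"
    using sum.remove[OF M i0(1), of "\<lambda>i. real (?d i)"] by simp
  \<comment> \<open>Both bounds on the degree of the Wronskian contain the sum of all
    \<open>?d i\<close>; cancelling it leaves Mason's inequality.\<close>
  finally have main: "real (?d i0) + (\<Sum>i<r. real i) \<le> real (r - 1) * (\<Sum>i\<in>M. \<Sum>j\<in>J i. real (?e i j))"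
    using degW sum_e by linarith
  have ke: "k i j * ?e i j \<le> ?d i0" if "i \<in> M" "j \<in> J i" for i j
  proof -
    have "k i j * ?e i j \<le> ?d i" unfolding deg_f[OF that(1)]
      using that J by (intro member_le_sum) auto
    then show ?thesis using i0(2)[OF that(1)] by linarith
  qed
  have "(\<Sum>i\<in>M. \<Sum>j\<in>J i. real (?e i j)) \<le> (\<Sum>i\<in>M. \<Sum>j\<in>J i. real (?d i0) * (1 / real (k i j)))"
  proof (intro sum_mono)
    fix i j assume ij: "i \<in> M" "j \<in> J i"
    have "real (k i j) * real (?e i j) \<le> real (?d i0)" using ke[OF ij] by (metis of_nat_le_iff of_nat_mult)
    then show "real (?e i j) \<le> real (?d i0) * (1 / real (k i j))"
      using k[OF ij] by (simp add: field_simps)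
  qed
  also have "\<dots> = real (?d i0) * (\<Sum>i\<in>M. \<Sum>j\<in>J i. 1 / real (k i j))"
    by (simp add: sum_distrib_left)
  also have "\<dots> \<le> real (?d i0) * (1 / (real ?m - 2))" by (rule mult_left_mono[OF le]) simp
  finally have e_le: "(\<Sum>i\<in>M. \<Sum>j\<in>J i. real (?e i j)) \<le> real (?d i0) / (real ?m - 2)" by simp
  \<comment> \<open>For \<open>r \<le> 1\<close> the right-hand side of \<open>main\<close> is zero.
    For larger \<open>r\<close> it is at most \<open>?d i0\<close> by the bound on reciprocals,
    which contradicts the positive sum over \<open>i < r\<close>.\<close>
  have "?d i0 = 0"
  proof (cases "r \<le> 1")
    case True
    have "(\<Sum>i<r. real i) \<ge> 0" by (simp add: sum_nonneg)
    then show ?thesis using main True by simp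
  next
    case False
    then have r: "real (r - 1) \<le> real ?m - 2" using rm by linarith
    have "real (r - 1) * (\<Sum>i\<in>M. \<Sum>j\<in>J i. real (?e i j)) \<le> real (r - 1) * (real (?d i0) / (real ?m - 2))"
      using e_le by (rule mult_left_mono) simp
    also have "\<dots> \<le> (real ?m - 2) * (real (?d i0) / (real ?m - 2))"
      using r m by (intro mult_right_mono) auto
    also have "\<dots> = real (?d i0)" using m by simp
    finally have "(\<Sum>i<r. real i) \<le> 0" using main by linarith
    moreover have "real 1 \<le> (\<Sum>i<r. real i)" using False by (intro member_le_sum) auto
    ultimately show ?thesis by linarith
  qed
  then have "?e i j = 0" using ke[OF i j] k[OF i j] by simp
  then show ?thesis by (simp add: ldeg_eq_0_iff)
qed

end

section \<open>Lifting a derivation to the free commutative ring\<close>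

locale derivation_domain = domain R for R :: "('a, 'm) ring_scheme" (structure) +
  fixes d :: "'a \<Rightarrow> 'a"
  assumes d_closed [simp]: "x \<in> carrier R \<Longrightarrow> d x \<in> carrier R"
    and d_add: "x \<in> carrier R \<Longrightarrow> y \<in> carrier R \<Longrightarrow> d (x \<oplus> y) = d x \<oplus> d y"
    and d_mult: "x \<in> carrier R \<Longrightarrow> y \<in> carrier R \<Longrightarrow> d (x \<otimes> y) = (d x \<otimes> y) \<oplus> (x \<otimes> d y)"
    and d_nilpotent: "x \<in> carrier R \<Longrightarrow> \<exists>n. (d ^^ n) x = \<zero>"
    and characteristic: "(n::nat) > 0 \<Longrightarrow> [n] \<cdot> \<one> \<noteq> \<zero>"
begin

section \<open>Evaluation of integer polynomials at ring elements\<close>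

text \<open>Elements of \<open>'a multiset \<Rightarrow>\<^sub>0 int\<close> are integer polynomials whose variables are the elements of \<open>'a\<close>; those
  outside the carrier evaluate to zero.\<close>

definition val :: "'a \<Rightarrow> 'a" where
  "val a = (if a \<in> carrier R then a else \<zero>)"

text \<open>The inner \<open>val\<close> makes the folded operation commute on all of \<open>'a\<close>.\<close>

definition mon :: "'a multiset \<Rightarrow> 'a" where
  "mon M = fold_mset (\<lambda>a y. val a \<otimes> val y) \<one> M"

definition ev :: "('a multiset \<Rightarrow>\<^sub>0 int) \<Rightarrow> 'a" where
  "ev p = (\<Oplus>M\<in>Poly_Mapping.keys p. [Poly_Mapping.lookup p M] \<cdot> mon M)"

text \<open>The Leibniz rule on a monomial: one occurrence of the variable \<open>a\<close> at a
  time is replaced by the variable that bears the name of its derivative.\<close>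

definition deriv_mon :: "'a multiset \<Rightarrow> ('a multiset \<Rightarrow>\<^sub>0 int)" where
  "deriv_mon M = (\<Sum>a\<in>#M. frag_of (add_mset (d (val a)) (M - {#a#})))"

definition lift_deriv :: "('a multiset \<Rightarrow>\<^sub>0 int) \<Rightarrow> ('a multiset \<Rightarrow>\<^sub>0 int)" where
  "lift_deriv = frag_extend deriv_mon"

lemma d_zero [simp]: "d \<zero> = \<zero>"
  using d_add[of \<zero> \<zero>] by (metis d_closed add.l_cancel_one r_zero zero_closed)

lemma d_one [simp]: "d \<one> = \<zero>"
  using d_mult[of \<one> \<one>] by (metis d_closed add.l_cancel_one l_one one_closed r_one)

lemma d_minus: "x \<in> carrier R \<Longrightarrow> d (\<ominus> x) = \<ominus> d x"
  using d_add[of "\<ominus> x" x] by (simp add: l_neg minus_equality)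

lemma val_closed [simp]: "val a \<in> carrier R"
  by (simp add: val_def)

lemma val_carrier [simp]: "a \<in> carrier R \<Longrightarrow> val a = a"
  by (simp add: val_def)

lemma mon_empty [simp]: "mon {#} = \<one>"
  by (simp add: mon_def)

lemma mon_closed_add: "mon M \<in> carrier R \<and> mon (add_mset a M) = val a \<otimes> mon M"
proof -
  interpret comp_fun_commute "\<lambda>a y. val a \<otimes> val y"
    by standard (auto simp: fun_eq_iff m_lcomm)
  have closed: "mon M \<in> carrier R"
    by (induction M) (simp_all add: mon_def)
  then show ?thesis using closed by (simp add: mon_def)
qed

lemma mon_closed [simp]: "mon M \<in> carrier R"
  using mon_closed_add by blast

lemma mon_add_mset [simp]: "mon (add_mset a M) = val a \<otimes> mon M"
  using mon_closed_add by blast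

lemma mon_union: "mon (M + N) = mon M \<otimes> mon N"
  by (induction M) (simp_all add: m_assoc)

lemma ev_closed [simp]: "ev p \<in> carrier R"
  unfolding ev_def by (intro finsum_closed) auto

lemma ev_superset:
  assumes "finite S" "Poly_Mapping.keys p \<subseteq> S"
  shows "ev p = (\<Oplus>M\<in>S. [Poly_Mapping.lookup p M] \<cdot> mon M)"
  unfolding ev_def using assms
  by (intro add.finprod_mono_neutral_cong_left) (auto simp: in_keys_iff add_pow_int_ge)

lemma ev_zero [simp]: "ev 0 = \<zero>"
  by (simp add: ev_def)

lemma ev_frag_of [simp]: "ev (frag_of M) = mon M"
  by (subst ev_superset[of "{M}"]) auto

lemma ev_add: "ev (p + q) = ev p \<oplus> ev q"
proof -
  let ?S = "Poly_Mapping.keys p \<union> Poly_Mapping.keys q"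
  have "ev (p + q) = (\<Oplus>M\<in>?S. [Poly_Mapping.lookup (p + q) M] \<cdot> mon M)"
    by (intro ev_superset) (auto dest: subsetD[OF Poly_Mapping.keys_add])
  also have "\<dots> = (\<Oplus>M\<in>?S. [Poly_Mapping.lookup p M] \<cdot> mon M \<oplus> [Poly_Mapping.lookup q M] \<cdot> mon M)"
    by (simp add: lookup_add add.int_pow_mult)
  also have "\<dots> = (\<Oplus>M\<in>?S. [Poly_Mapping.lookup p M] \<cdot> mon M) \<oplus> (\<Oplus>M\<in>?S. [Poly_Mapping.lookup q M] \<cdot> mon M)"
    by (intro finsum_addf) auto
  also have "\<dots> = ev p \<oplus> ev q" by (subst (1 2) ev_superset[of ?S]) auto
  finally show ?thesis .
qed

lemma ev_uminus: "ev (- p) = \<ominus> ev p"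
  using ev_add[of "- p" p] by (simp add: minus_equality)

lemma ev_diff: "ev (p - q) = ev p \<ominus> ev q"
  using ev_add[of p "- q"] by (simp add: ev_uminus a_minus_def)

text \<open>Both sides are additive in each argument, so two inductions reduce the claim to
  monomials.\<close>

lemma ev_mult: "ev (p * q) = ev p \<otimes> ev q"
proof -
  have mono: "ev (frag_of M * q) = mon M \<otimes> ev q" for M
    using subset_UNIV[of "Poly_Mapping.keys q"]
  proof (induction q rule: frag_induction)
    case (one N) then show ?case by (simp add: mult_single mon_union)
  next
    case (diff p q) then show ?case by (simp add: right_diff_distrib ev_diff a_minus_def r_distr r_minus)
  qed simp
  show ?thesis
    using subset_UNIV[of "Poly_Mapping.keys p"]
  proof (induction p rule: frag_induction)
    case (one N) then show ?case by (simp add: mono)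
  next
    case (diff p p') then show ?case by (simp add: left_diff_distrib ev_diff a_minus_def l_distr l_minus)
  qed simp
qed

lemma frag_of_empty: "frag_of ({#} :: 'x multiset) = 1"
  by (metis single_one zero_multiset_def)

lemma ev_one [simp]: "ev 1 = \<one>"
  using ev_frag_of[of "{#}"] by (simp only: frag_of_empty mon_empty)

lemma ev_of_nat: "ev (of_nat n) = [n] \<cdot> \<one>"
  by (induction n) (simp_all add: ev_add a_comm)

lemma ev_sum: "finite S \<Longrightarrow> ev (sum g S) = (\<Oplus>i\<in>S. ev (g i))"
  by (induction S rule: finite_induct) (simp_all add: ev_add Pi_def)

lemma ev_prod: "finite S \<Longrightarrow> ev (prod g S) = (\<Otimes>i\<in>S. ev (g i))"
  by (induction S rule: finite_induct) (simp_all add: ev_mult Pi_def)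

lemma ev_power: "ev (p ^ n) = ev p [^] n"
  by (induction n) (simp_all add: ev_mult m_comm)

text \<open>An occurrence in \<open>M + N\<close> lies in \<open>M\<close> or in \<open>N\<close>,
  and replacing it leaves the other multiset intact.\<close>

lemma deriv_mon_union:
  "deriv_mon (M + N) = deriv_mon M * frag_of N + frag_of M * deriv_mon N"
proof -
  have 1: "(\<Sum>a\<in>#M. frag_of (add_mset (d (val a)) (M + N - {#a#})) :: 'a multiset \<Rightarrow>\<^sub>0 int)
      = (\<Sum>a\<in>#M. frag_of (add_mset (d (val a)) (M - {#a#})) * frag_of N)"
    by (intro arg_cong[of _ _ sum_mset] image_mset_cong)
      (simp add: mult_single)
  have 2: "(\<Sum>a\<in>#N. frag_of (add_mset (d (val a)) (M + N - {#a#})) :: 'a multiset \<Rightarrow>\<^sub>0 int)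
      = (\<Sum>a\<in>#N. frag_of M * frag_of (add_mset (d (val a)) (N - {#a#})))"
    by (intro arg_cong[of _ _ sum_mset] image_mset_cong)
      (simp add: mult_single)
  show ?thesis
    by (simp add: deriv_mon_def 1 2 sum_mset_distrib_left sum_mset_distrib_right image_mset.compositionality comp_def)
qed

lemma ev_deriv_mon: "ev (deriv_mon M) = d (mon M)"
proof (induction M)
  case (add a M)
  have "deriv_mon (add_mset a M) = deriv_mon {#a#} * frag_of M + frag_of {#a#} * deriv_mon M"
    using deriv_mon_union[of "{#a#}" M] by simp
  then show ?case
    by (simp add: ev_add ev_mult add.IH d_mult) (simp add: deriv_mon_def)
qed (simp add: deriv_mon_def)

text \<open>Both sides are additive, so monomials suffice. This makes the kernel of
  \<open>ev\<close> stable under the lift and transfers nilpotency from \<open>d\<close>.\<close>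

lemma ev_lift_deriv: "ev (lift_deriv p) = d (ev p)"
  using subset_UNIV[of "Poly_Mapping.keys p"]
proof (induction p rule: frag_induction)
  case (diff p q)
  then show ?case by (simp add: lift_deriv_def frag_extend_diff ev_diff a_minus_def d_add d_minus)
qed (simp_all add: lift_deriv_def ev_deriv_mon)

lemma ev_lift_deriv_funpow: "ev ((lift_deriv ^^ n) p) = (d ^^ n) (ev p)"
  by (induction n) (simp_all add: ev_lift_deriv)

lemma lift_deriv_mult: "lift_deriv (p * q) = lift_deriv p * q + p * lift_deriv q"
proof -
  have mono: "lift_deriv (frag_of M * q) = deriv_mon M * q + frag_of M * lift_deriv q" for M
    using subset_UNIV[of "Poly_Mapping.keys q"]
  proof (induction q rule: frag_induction)
    case (one N) then show ?case by (simp add: mult_single lift_deriv_def deriv_mon_union)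
  next
    case (diff p q) then show ?case
      by (simp add: right_diff_distrib lift_deriv_def frag_extend_diff)
  qed (simp add: lift_deriv_def)
  show ?thesis
    using subset_UNIV[of "Poly_Mapping.keys p"]
  proof (induction p rule: frag_induction)
    case (one N) then show ?case by (simp add: mono) (simp add: lift_deriv_def)
  next
    case (diff p p') then show ?case
      by (simp add: left_diff_distrib lift_deriv_def frag_extend_diff)
  qed (simp add: lift_deriv_def)
qed

text \<open>The kernel of \<open>ev\<close> is prime because \<open>R\<close> is a domain. As every
  element of \<open>R\<close> is the value of a variable, the quotient by this kernel is
  \<open>R\<close> itself.\<close>

sublocale lift: locally_nilpotent_mod_prime lift_deriv "{p. ev p = \<zero>}"
proof
  show "lift_deriv (p + q) = lift_deriv p + lift_deriv q" for p q
    by (simp add: lift_deriv_def frag_extend_add)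
  show "lift_deriv (p * q) = lift_deriv p * q + p * lift_deriv q" for p q
    by (rule lift_deriv_mult)
  show "p \<in> {p. ev p = \<zero>} \<or> q \<in> {p. ev p = \<zero>}" if "p * q \<in> {p. ev p = \<zero>}" for p q
    using that integral[of "ev p" "ev q"] by (simp add: ev_mult)
  show "\<exists>n. (lift_deriv ^^ n) p \<in> {p. ev p = \<zero>}" for p
    using d_nilpotent[of "ev p"] by (simp add: ev_lift_deriv_funpow)
qed (auto simp: ev_add ev_mult ev_of_nat ev_lift_deriv characteristic)

text \<open>Lifting each element to the variable bearing its name reduces the claim to
  \<open>lift.mason_const\<close>; relative primality has to be translated from ideals into
  congruences.\<close>

theorem mason_derivation:
  fixes f :: "'i \<Rightarrow> 'a" and b :: "'i \<Rightarrow> 'j \<Rightarrow> 'a"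
  assumes M: "finite M" and m: "card M \<ge> 3" and J: "\<And>i. i \<in> M \<Longrightarrow> finite (J i)"
    and c: "\<And>i. i \<in> M \<Longrightarrow> c i \<in> carrier R" "\<And>i. i \<in> M \<Longrightarrow> d (c i) = \<zero>"
    and b: "\<And>i j. i \<in> M \<Longrightarrow> j \<in> J i \<Longrightarrow> b i j \<in> carrier R"
    and f: "\<And>i. i \<in> M \<Longrightarrow> f i = c i \<otimes> (\<Otimes>j\<in>J i. b i j [^] k i j)"
    and fZ: "\<And>i. i \<in> M \<Longrightarrow> f i \<noteq> \<zero>" and f0: "(\<Oplus>i\<in>M. f i) = \<zero>"
    and cop: "\<And>i j. i \<in> M \<Longrightarrow> j \<in> M \<Longrightarrow> i \<noteq> j \<Longrightarrow> relatively_prime R (f i) (f j)"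
    and k: "\<And>i j. i \<in> M \<Longrightarrow> j \<in> J i \<Longrightarrow> k i j \<ge> 1"
    and le: "(\<Sum>i\<in>M. \<Sum>j\<in>J i. 1 / real (k i j)) \<le> 1 / (real (card M) - 2)"
    and i: "i \<in> M" and j: "j \<in> J i"
  shows "d (b i j) = \<zero>"
proof -
  let ?x = "\<lambda>a. frag_of {#a#} :: 'a multiset \<Rightarrow>\<^sub>0 int"
  define g where "g i = ?x (c i) * (\<Prod>j\<in>J i. ?x (b i j) ^ k i j)" for i
  have fc: "f i \<in> carrier R" if "i \<in> M" for i
    using that b c by (auto simp: f[OF that])
  have ev_g: "ev (g i) = f i" if "i \<in> M" for i
  proof -
    have "(\<Otimes>j\<in>J i. ev (?x (b i j) ^ k i j)) = (\<Otimes>j\<in>J i. b i j [^] k i j)"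
      using b that by (intro finprod_cong') (auto simp: ev_power)
    then show ?thesis using c that J by (simp add: g_def f ev_mult ev_prod)
  qed
  have "lift_deriv (?x (b i j)) \<in> {p. ev p = \<zero>}"
  proof (rule lift.mason_const[OF M m J _ g_def _ _ _ k le i j])
    show "lift_deriv (?x (c i)) \<in> {p. ev p = \<zero>}" if "i \<in> M" for i
      using c that by (simp add: ev_lift_deriv)
    show "g i \<notin> {p. ev p = \<zero>}" if "i \<in> M" for i
      using fZ ev_g that by simp
    have "(\<Oplus>i\<in>M. ev (g i)) = (\<Oplus>i\<in>M. f i)"
      using ev_g fc by (intro finsum_cong') auto
    then show "(\<Sum>i\<in>M. g i) \<in> {p. ev p = \<zero>}" using f0 M by (simp add: ev_sum)
  next
    fix i j assume ij: "i \<in> M" "j \<in> M" "i \<noteq> j"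
    show "lift.coprimeZ (g i) (g j)"
      unfolding lift.coprimeZ_def
    proof (intro allI impI)
      fix y z assume "g i * y - g j * z \<in> {p. ev p = \<zero>}"
      then have eq: "f i \<otimes> ev y = f j \<otimes> ev z"
        using ij fc by (simp add: ev_diff ev_mult ev_g r_right_minus_eq)
      have "f i \<otimes> ev y = ev y \<otimes> f i" "f i \<otimes> ev y = ev z \<otimes> f j"
        using fc ij eq by (simp_all add: m_comm)
      \<comment> \<open>The common value is a multiple of both elements, so relative primality makes
        it a multiple of their product.\<close>
      then have "f i \<otimes> ev y \<in> PIdl (f i) \<inter> PIdl (f j)"
        unfolding cgenideal_def using ev_closed by (intro IntI CollectI exI conjI)
      then have "f i \<otimes> ev y \<in> PIdl (f i \<otimes> f j)"
        using cop[OF ij] unfolding relatively_prime_def by simp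
      then obtain t where t: "t \<in> carrier R" "f i \<otimes> ev y = t \<otimes> (f i \<otimes> f j)"
        unfolding cgenideal_def by blast
      then have "f i \<otimes> ev y = f i \<otimes> (f j \<otimes> t)" using fc ij by (simp add: m_ac)
      \<comment> \<open>Cancellation in the domain uses that \<open>f i\<close> is nonzero.\<close>
      then have "ev y = f j \<otimes> t" using fc ij fZ t(1) m_lcancel by simp
      then have "y - g j * ?x t \<in> {p. ev p = \<zero>}"
        using t(1) ij fc by (simp add: ev_diff ev_mult ev_g)
      then show "\<exists>t. y - g j * t \<in> {p. ev p = \<zero>}" by blast
    qed
  qed
  then show ?thesis using b[OF i j] by (simp add: ev_lift_deriv)
qed

end

section \<open>Rigidity\<close>

text \<open>Relative primality does not exclude a vanishing \<open>f i\<close>, because zero is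
  relatively prime to every element. \<open>f_nonzero\<close> excludes it, as the degree argument
  computes with nonzero elements.\<close>

theorem corollary4p1:
  fixes K :: "('k, 'p) ring_scheme"
    and B :: "('k, 'b, 'q) module_scheme"
    and A :: "('k, 'b set) module"
    and m :: nat and n :: "nat \<Rightarrow> nat"
    and a :: "nat \<Rightarrow> 'k"
    and k :: "nat \<Rightarrow> nat \<Rightarrow> nat"
    and b :: "nat \<Rightarrow> nat \<Rightarrow> 'b"
    and Fi :: "nat \<Rightarrow> 'b" and F :: 'b
    and f :: "nat \<Rightarrow> 'b set"
  assumes "algebraically_closed K" and "char_zero K"
    and "algebra K B" and "domain B"
    and "m \<ge> 3"
    and "\<And>i. i \<in> {1..m} \<Longrightarrow> n i \<ge> 1"
    and "\<And>i. i \<in> {1..m} \<Longrightarrow> a i \<in> carrier K - {\<zero>\<^bsub>K\<^esub>}"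
    and "\<And>i j. i \<in> {1..m} \<Longrightarrow> j \<in> {1..n i} \<Longrightarrow> k i j \<ge> 1"
    and "\<And>i j. i \<in> {1..m} \<Longrightarrow> j \<in> {1..n i} \<Longrightarrow> b i j \<in> carrier B"
    and "generated_algebra K B {b i j | i j. i \<in> {1..m} \<and> j \<in> {1..n i}} = carrier B"
    and "\<And>i. i \<in> {1..m} \<Longrightarrow> Fi i = a i \<odot>\<^bsub>B\<^esub> (\<Otimes>\<^bsub>B\<^esub>j\<in>{1..n i}. b i j [^]\<^bsub>B\<^esub> k i j)"
    and "F = (\<Oplus>\<^bsub>B\<^esub>i\<in>{1..m}. Fi i)"
    and "ring_prime\<^bsub>B\<^esub> F"
    and "A = quotient_algebra B (PIdl\<^bsub>B\<^esub> F)"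
    and "\<And>i. i \<in> {1..m} \<Longrightarrow> f i = PIdl\<^bsub>B\<^esub> F +>\<^bsub>B\<^esub> Fi i"
    and f_nonzero: "\<And>i. i \<in> {1..m} \<Longrightarrow> f i \<noteq> \<zero>\<^bsub>A\<^esub>"
    and "\<And>i j. i \<in> {1..m} \<Longrightarrow> j \<in> {1..m} \<Longrightarrow> i \<noteq> j \<Longrightarrow> relatively_prime A (f i) (f j)"
    and "(\<Sum>i=1..m. \<Sum>j=1..n i. 1 / real (k i j)) \<le> 1 / (real m - 2)"
  shows "rigid K A"
proof -
  define I where "I = PIdl\<^bsub>B\<^esub> F"
  define \<pi> where "\<pi> = a_r_coset B I"
  interpret B: domain B by fact
  interpret KB: algebra K B by fact
  have K: "field K" using assms(1) by (simp add: algebraically_closed_def)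
  interpret K: field K by fact
  have Fi: "Fi i \<in> carrier B" if "i \<in> {1..m}" for i
    using that assms(7,9,11) by (auto intro!: B.finprod_closed)
  have F: "F \<in> carrier B" using Fi by (auto simp: assms(12))
  have prime: "primeideal I B"
    unfolding I_def using B.primeideal_iff_prime F assms(13) by (auto simp: ring_prime_def)
  then have I: "ideal I B" by (rule primeideal.axioms)
  interpret I: primeideal I B by fact
  interpret Q: domain "B Quot I" by (rule I.quotient_is_domain)
  have A: "A = quotient_algebra B I" using assms(14) by (simp add: I_def)
  interpret KA: algebra K A unfolding A by (rule algebra_quotient_algebra[OF assms(3) I])
  have hom: "\<pi> \<in> Ring.ring_hom B A"
    using I.rcos_ring_hom by (simp add: A Ring.ring_hom_def \<pi>_def)
  interpret \<pi>: ring_hom_cring B A \<pi>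
    by (intro ring_hom_cring.intro ring_hom_cring_axioms.intro hom B.is_cring KA.M_cring)
  have rep: "\<exists>x\<in>carrier B. C = \<pi> x" if "C \<in> carrier A" for C
    using that by (auto simp: A \<pi>_def FactRing_def A_RCOSETS_def')
  have smult: "\<pi> (c \<odot>\<^bsub>B\<^esub> x) = c \<odot>\<^bsub>A\<^esub> \<pi> x" if "c \<in> carrier K" "x \<in> carrier B" for c x
    unfolding A \<pi>_def using smult_quotient_algebra[OF assms(3) I that] by simp
  have A_dom: "domain A"
    by (rule domain.intro[OF KA.M_cring domain_axioms.intro]) (simp_all add: A Q.one_not_zero Q.integral)
  interpret A: domain A by fact
  show ?thesis
    unfolding rigid_def
  proof (intro notI, elim exE conjE bexE)
    fix D r assume D: "derivation K A D" "locally_nilpotent A D" and r: "r \<in> carrier A" "D r \<noteq> \<zero>\<^bsub>A\<^esub>"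
    have D_smult: "D (c \<odot>\<^bsub>A\<^esub> x) = c \<odot>\<^bsub>A\<^esub> D x" if "c \<in> carrier K" "x \<in> carrier A" for c x
      using D(1) that by (auto simp: derivation_def)
    \<comment> \<open>Scalars embed into \<open>A\<close> because nonzero ones are invertible; this
      transfers characteristic zero from \<open>K\<close>.\<close>
    have scalar_zero: "c = \<zero>\<^bsub>K\<^esub>" if "c \<in> carrier K" "c \<odot>\<^bsub>A\<^esub> \<one>\<^bsub>A\<^esub> = \<zero>\<^bsub>A\<^esub>" for c
    proof (rule ccontr)
      assume "c \<noteq> \<zero>\<^bsub>K\<^esub>"
      then have c: "inv\<^bsub>K\<^esub> c \<in> carrier K" "inv\<^bsub>K\<^esub> c \<otimes>\<^bsub>K\<^esub> c = \<one>\<^bsub>K\<^esub>"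
        using that(1) K.field_Units by auto
      have "\<one>\<^bsub>A\<^esub> = (inv\<^bsub>K\<^esub> c \<otimes>\<^bsub>K\<^esub> c) \<odot>\<^bsub>A\<^esub> \<one>\<^bsub>A\<^esub>" using c by simp
      also have "\<dots> = inv\<^bsub>K\<^esub> c \<odot>\<^bsub>A\<^esub> (c \<odot>\<^bsub>A\<^esub> \<one>\<^bsub>A\<^esub>)"
        using c that(1) by (intro KA.smult_assoc1) auto
      also have "\<dots> = \<zero>\<^bsub>A\<^esub>" using c(1) that(2) by simp
      finally show False by simp
    qed
    have nat_smult: "[n] \<cdot>\<^bsub>A\<^esub> \<one>\<^bsub>A\<^esub> = ([n] \<cdot>\<^bsub>K\<^esub> \<one>\<^bsub>K\<^esub>) \<odot>\<^bsub>A\<^esub> \<one>\<^bsub>A\<^esub>" for n :: nat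
      by (induction n) (simp_all add: KA.smult_l_distr)
    interpret derivation_domain A D
    proof
      show "[n] \<cdot>\<^bsub>A\<^esub> \<one>\<^bsub>A\<^esub> \<noteq> \<zero>\<^bsub>A\<^esub>" if "n > 0" for n :: nat
        using scalar_zero[of "[n] \<cdot>\<^bsub>K\<^esub> \<one>\<^bsub>K\<^esub>"] assms(2) that by (auto simp: nat_smult char_zero_def)
    qed (use D in \<open>auto simp: derivation_def locally_nilpotent_def\<close>)
    \<comment> \<open>The scalar \<open>a i\<close> becomes a multiple of the unit of
      \<open>A\<close>, which \<open>D\<close> kills by linearity; it is the constant factor in
      \<open>mason_derivation\<close>.\<close>
    have f_eq: "f i = (a i \<odot>\<^bsub>A\<^esub> \<one>\<^bsub>A\<^esub>) \<otimes>\<^bsub>A\<^esub> (\<Otimes>\<^bsub>A\<^esub>j\<in>{1..n i}. \<pi> (b i j) [^]\<^bsub>A\<^esub> k i j)"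
      if i: "i \<in> {1..m}" for i
    proof -
      let ?P = "\<Otimes>\<^bsub>B\<^esub>j\<in>{1..n i}. b i j [^]\<^bsub>B\<^esub> k i j"
      have P: "?P \<in> carrier B" using assms(9)[OF i] by (intro B.finprod_closed) auto
      have "\<pi> ?P = (\<Otimes>\<^bsub>A\<^esub>j\<in>{1..n i}. \<pi> (b i j [^]\<^bsub>B\<^esub> k i j))"
        using assms(9)[OF i] by (subst \<pi>.hom_finprod) (auto simp: comp_def)
      also have "\<dots> = (\<Otimes>\<^bsub>A\<^esub>j\<in>{1..n i}. \<pi> (b i j) [^]\<^bsub>A\<^esub> k i j)"
        using assms(9)[OF i] by (intro KA.finprod_cong') auto
      finally have \<pi>P: "\<pi> ?P = (\<Otimes>\<^bsub>A\<^esub>j\<in>{1..n i}. \<pi> (b i j) [^]\<^bsub>A\<^esub> k i j)" .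
      have "f i = a i \<odot>\<^bsub>A\<^esub> \<pi> ?P"
        using assms(15)[OF i] assms(11)[OF i] smult assms(7)[OF i] P by (simp add: \<pi>_def I_def)
      also have "\<dots> = (a i \<odot>\<^bsub>A\<^esub> \<one>\<^bsub>A\<^esub>) \<otimes>\<^bsub>A\<^esub> \<pi> ?P"
        using KA.smult_assoc2[of "a i" "\<one>\<^bsub>A\<^esub>" "\<pi> ?P"] assms(7)[OF i] P by simp
      finally show ?thesis unfolding \<pi>P .
    qed
    have f_\<pi>: "f i = \<pi> (Fi i)" if "i \<in> {1..m}" for i
      using assms(15)[OF that] by (simp add: \<pi>_def I_def)
    have f_sum: "(\<Oplus>\<^bsub>A\<^esub>i\<in>{1..m}. f i) = \<zero>\<^bsub>A\<^esub>"
    proof -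
      have "(\<Oplus>\<^bsub>A\<^esub>i\<in>{1..m}. f i) = (\<Oplus>\<^bsub>A\<^esub>i\<in>{1..m}. \<pi> (Fi i))"
        using f_\<pi> \<pi>.hom_closed[OF Fi] by (intro KA.M.finsum_cong') simp_all
      also have "\<dots> = \<pi> F"
        unfolding assms(12) using Fi by (subst \<pi>.hom_finsum) (auto simp: comp_def)
      also have "\<dots> = \<zero>\<^bsub>A\<^esub>"
        using B.cgenideal_self[OF F] I.a_rcos_const[of F] F
        by (simp add: \<pi>_def I_def A FactRing_def)
      finally show ?thesis .
    qed
    have Db: "D (\<pi> (b i j)) = \<zero>\<^bsub>A\<^esub>" if ij: "i \<in> {1..m}" "j \<in> {1..n i}" for i j
    proof (rule mason_derivation[where M = "{1..m}" and J = "\<lambda>i. {1..n i}" and k = k and f = f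
          and c = "\<lambda>i. a i \<odot>\<^bsub>A\<^esub> \<one>\<^bsub>A\<^esub>" and b = "\<lambda>i j. \<pi> (b i j)"])
      show "D (a i \<odot>\<^bsub>A\<^esub> \<one>\<^bsub>A\<^esub>) = \<zero>\<^bsub>A\<^esub>" if "i \<in> {1..m}" for i
        using assms(7)[OF that] by (simp add: D_smult)
      show "\<pi> (b i j) \<in> carrier A" if "i \<in> {1..m}" "j \<in> {1..n i}" for i j
        using assms(9)[OF that] by simp
      show "(\<Sum>i=1..m. \<Sum>j=1..n i. 1 / real (k i j)) \<le> 1 / (real (card {1..m}) - 2)"
        using assms(18) by simp
    qed (use assms(5,7,8,17) f_nonzero f_eq f_sum ij in simp_all)
    \<comment> \<open>The preimage of the kernel of \<open>D\<close> is a unital subalgebra. It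
      contains the generators, hence is all of \<open>B\<close>, and \<open>D\<close> vanishes on
      \<open>A\<close> because the projection is onto.\<close>
    define V where "V = {x \<in> carrier B. D (\<pi> x) = \<zero>\<^bsub>A\<^esub>}"
    have "subring V B"
      by (rule B.subringI) (auto simp: V_def d_add d_mult d_minus)
    then have "unital_subalgebra K V B"
      unfolding unital_subalgebra_def by (auto simp: V_def smult D_smult)
    moreover have "{b i j | i j. i \<in> {1..m} \<and> j \<in> {1..n i}} \<subseteq> V"
      using Db assms(9) by (auto simp: V_def)
    ultimately have "carrier B \<subseteq> V"
      using assms(10) unfolding generated_algebra_def by blast
    moreover obtain x where "x \<in> carrier B" "r = \<pi> x" using rep[OF r(1)] by blast
    ultimately show False using r(2) by (auto simp: V_def)
  qed
qed

end
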